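(* For every $\rho\in\mathcal P^-$ it holds $$\overline C(\rho)=\inf\left\{\sum_{k=1}^N \mathcal C_k(\rho_k)\ :\ \rho_k\in\mathcal P^-\ (1\le k\le N),\ \sum_{k=1}^N\frac{k}{N}\rho_k=\rho,\ \sum_{k=1}^N\|\rho_k\|\le 1\right\}.$$ Moreover the infimum is attained whenever $\overline C(\rho)<+\infty$.
   Context: Let $d\ge1$ and $N\ge 2$ be integers. $\mathcal P$ is the set of Borel probability measures on $\mathbb R^d$; $\mathcal P^-$ is the set of nonnegative Borel measures $\rho$ on $\mathbb R^d$ with total mass $\|\rho\|=\rho(\mathbb R^d)\le 1$. $\rho_n\stackrel{*}{\rightharpoonup}\rho$ denotes weak* convergence of measures in duality with $C_0$, the continuous functions on $\mathbb R^d$ vanishing at infinity. For $k\ge1$ let $c_k(x_1,\dots,x_k)=\sum_{1\le i<j\le k}\frac1{|x_i-x_j|}$ for $x_i\in\mathbb R^d$ (with $1/0=+\infty$, and $c_1=0$), and $c=c_N$. For $\rho\in\mathcal P$, $C(\rho)=\inf\{\int_{(\mathbb R^d)^N} c\,dP : P \text{ Borel probability on }(\mathbb R^d)^N \text{ with all } N \text{ marginals on } \mathbb R^d \text{ equal to } \rho\}$. For $\rho\in\mathcal P^-$, the relaxed cost is $\overline C(\rho)=\inf\{\liminf_n C(\rho_n) : \rho_n\in\mathcal P,\ \rho_n\stackrel{*}{\rightharpoonup}\rho\}$. For $2\le k\le N$ and $\mu\in\mathcal P^-$, $\mathcal C_k(\mu)=\inf\{\int_{(\mathbb R^d)^k}c_k\,dP\}$,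 the infimum being over nonnegative Borel measures $P$ on $(\mathbb R^d)^k$ all of whose $k$ marginals on $\mathbb R^d$ equal $\mu$ (so $\|P\|=\|\mu\|$). Also $\mathcal C_1\equiv 0$ on $\mathcal P^-$. *)

theory Defs
  imports "HOL-Probability.Probability"
begin

definition Probs :: "(real ^ 'd) measure set" where
  "Probs = {\<rho>. sets \<rho> = sets borel \<and> prob_space \<rho>}"

definition Subprobs :: "(real ^ 'd) measure set" where
  "Subprobs = {\<rho>. sets \<rho> = sets borel \<and> emeasure \<rho> UNIV \<le> 1}"

definition C0_functions :: "(real ^ 'd \<Rightarrow> real) set" where
  "C0_functions = {f. continuous_on UNIV f \<and> (f \<longlongrightarrow> 0) at_infinity}"

definition weak_star_conv ::
    "(nat \<Rightarrow> (real ^ 'd) measure) \<Rightarrow> (real ^ 'd) measure \<Rightarrow> bool" where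
  "weak_star_conv \<rho>s \<rho> \<longleftrightarrow>
     (\<forall>f\<in>C0_functions. (\<lambda>n. \<integral>x. f x \<partial>\<rho>s n) \<longlonglongrightarrow> (\<integral>x. f x \<partial>\<rho>))"

text \<open>The \<open>k\<close>-fold product of \<open>real ^ 'd\<close> is the space of extensional functions on
  \<open>{1..k}\<close>, with the product sigma-algebra; since \<open>real ^ 'd\<close> is second countable,
  this is the Borel sigma-algebra of the product topology.\<close>

abbreviation config_space :: "nat \<Rightarrow> (nat \<Rightarrow> real ^ 'd) measure" where
  "config_space k \<equiv> PiM {1..k} (\<lambda>_. borel)"

text \<open>In \<open>ennreal\<close>, \<open>1 / 0 = \<infinity>\<close>.\<close>

definition coulomb :: "nat \<Rightarrow> (nat \<Rightarrow> real ^ 'd) \<Rightarrow> ennreal" where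
  "coulomb k x =
     (\<Sum>(i, j) \<in> {(i, j). 1 \<le> i \<and> i < j \<and> j \<le> k}. 1 / ennreal (norm (x i - x j)))"

definition couplings ::
    "nat \<Rightarrow> (real ^ 'd) measure \<Rightarrow> (nat \<Rightarrow> real ^ 'd) measure set" where
  "couplings k \<mu> = {P. sets P = sets (config_space k) \<and>
                       (\<forall>i\<in>{1..k}. distr P borel (\<lambda>x. x i) = \<mu>)}"

definition mm_cost :: "nat \<Rightarrow> (real ^ 'd) measure \<Rightarrow> ennreal" where
  "mm_cost N \<rho> = (INF P \<in> {P \<in> couplings N \<rho>. prob_space P}. \<integral>\<^sup>+ x. coulomb N x \<partial>P)"

definition relaxed_cost :: "nat \<Rightarrow> (real ^ 'd) measure \<Rightarrow> ennreal" where
  "relaxed_cost N \<rho> =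
     (INF \<rho>s \<in> {\<rho>s. (\<forall>n. \<rho>s n \<in> Probs) \<and> weak_star_conv \<rho>s \<rho>}.
        liminf (\<lambda>n. mm_cost N (\<rho>s n)))"

definition partial_cost :: "nat \<Rightarrow> (real ^ 'd) measure \<Rightarrow> ennreal" where
  "partial_cost k \<mu> =
     (if k = 1 then 0 else (INF P \<in> couplings k \<mu>. \<integral>\<^sup>+ x. coulomb k x \<partial>P))"

text \<open>The identity between the measures \<open>\<Sum>k. (k/N) \<rho>\<^sub>k\<close> and \<open>\<rho>\<close> is stated
  setwise.\<close>

definition decompositions ::
    "nat \<Rightarrow> (real ^ 'd) measure \<Rightarrow> (nat \<Rightarrow> (real ^ 'd) measure) set" where
  "decompositions N \<rho> = {\<rho>s.
     (\<forall>k\<in>{1..N}. \<rho>s k \<in> Subprobs) \<and>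
     (\<forall>A\<in>sets borel. (\<Sum>k=1..N. ennreal (real k / real N) * emeasure (\<rho>s k) A) = emeasure \<rho> A) \<and>
     (\<Sum>k=1..N. emeasure (\<rho>s k) UNIV) \<le> 1}"

end

theory Submission
  imports Defs
begin

text \<open>
  Compactify \<open>real ^ 'd\<close> by the closed unit ball, so that mass escaping to infinity is kept on the unit
  sphere. A weak limit of optimal plans for \<open>\<rho>\<^sub>n\<close> on the compactified configuration space splits
  according to the set \<open>S\<close> of particles that stay at finite distance: the part with \<open>card S = k\<close>,
  projected to the finite particles and symmetrized, is a \<open>k\<close>-particle plan whose marginal is
  \<open>\<rho>\<^sub>k\<close>; counting finite particles gives \<open>\<Sum>k. (k/N) \<rho>\<^sub>k = \<rho>\<close>, and interactions involving a
  particle at infinity vanish. The same compactness, applied to a minimizing sequence of such limit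
  plans, yields a minimizer. Conversely, given \<open>k\<close>-particle plans, one adds \<open>N - k\<close> particles far away
  from everything, at mutual distance tending to infinity, and symmetrizes.

  Compactness of probability measures on the compactified space is reduced to Helly's theorem on the
  line: configurations are read off from a real parameter along a Schoenberg space-filling curve,
  which has a Borel section.
\<close>

section \<open>Finite mixtures and symmetrization\<close>

text \<open>The space-filling curve is continuous, but its section, which interleaves binary digits,
  is only Borel. This asymmetry is enough: plans are pushed to the line by the section, test
  functions are pulled back along the curve and stay continuous, so weak limits on the line can be
  read as limits of configurations.

  Only lower semicontinuity of the energy can be expected. The pair kernel is infinite at
  coincidences, and it is discontinuous where two particles reach the same boundary point: two
  particles that escape together at a bounded distance lose their interaction in the limit. This
  loss goes in the favourable direction. The kernel is therefore built as an increasing limit of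
  bounded continuous kernels.

  A minimizing decomposition is obtained without showing that the infimum defining each
  \<open>partial_cost\<close> is attained. One limit plan yields all \<open>\<rho>s k\<close> at
  once, with total partial cost at most its energy, and the reverse inequality holds for every
  decomposition, by means of almost optimal couplings.\<close>

lemma mixture_exists:
  fixes w :: "'i \<Rightarrow> ennreal"
  assumes fin: "finite I" and X: "\<And>i. i \<in> I \<Longrightarrow> X i \<in> measurable (M i) B"
  shows "\<exists>\<mu>. sets \<mu> = sets B \<and>
    (\<forall>A\<in>sets B. emeasure \<mu> A = (\<Sum>i\<in>I. w i * emeasure (M i) (X i -` A \<inter> space (M i))))"
proof -
  define f where "f A = (\<Sum>i\<in>I. w i * emeasure (M i) (X i -` A \<inter> space (M i)))" for A
  define \<mu> where "\<mu> = measure_of (space B) (sets B) f"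
  have s: "sets \<mu> = sets B" by (simp add: \<mu>_def)
  have ca: "countably_additive (sets \<mu>) f"
  proof (rule countably_additiveI)
    fix A :: "nat \<Rightarrow> 'b set"
    assume A: "range A \<subseteq> sets \<mu>" "disjoint_family A" "(\<Union>i. A i) \<in> sets \<mu>"
    have "(\<Sum>n. f (A n)) = (\<Sum>i\<in>I. \<Sum>n. w i * emeasure (M i) (X i -` A n \<inter> space (M i)))"
      unfolding f_def by (rule suminf_sum) simp
    also have "\<dots> = f (\<Union>i. A i)"
      unfolding f_def
    proof (rule sum.cong[OF refl])
      fix i assume i: "i \<in> I"
      have "(\<Sum>n. emeasure (M i) (X i -` A n \<inter> space (M i))) = emeasure (M i) (\<Union>n. X i -` A n \<inter> space (M i))"
        using A X[OF i] s
        by (intro suminf_emeasure) (auto simp: disjoint_family_on_def intro!: measurable_sets[OF X[OF i]])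
      also have "(\<Union>n. X i -` A n \<inter> space (M i)) = X i -` (\<Union>n. A n) \<inter> space (M i)" by auto
      finally show "(\<Sum>n. w i * emeasure (M i) (X i -` A n \<inter> space (M i))) =
          w i * emeasure (M i) (X i -` (\<Union>n. A n) \<inter> space (M i))"
        by simp
    qed
    finally show "(\<Sum>i. f (A i)) = f (\<Union>i. A i)" .
  qed
  have "emeasure \<mu> A = f A" if "A \<in> sets B" for A
    using that s ca
    by (intro emeasure_measure_of[OF \<mu>_def]) (auto simp: positive_def f_def sets.space_closed)
  with s show ?thesis unfolding f_def by blast
qed

text \<open>The setwise formula says that \<mu> is the weighted sum of the images of
  \<open>M i\<close> under \<open>X i\<close>; the integrands that obey it are closed under sums,
  multiples and increasing limits. Both the symmetrization and the gluing of plans with different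
  numbers of finite particles rest on this.\<close>

lemma nn_integral_mixture:
  fixes w :: "'i \<Rightarrow> ennreal"
  assumes fin: "finite I" and X[measurable]: "\<And>i. i \<in> I \<Longrightarrow> X i \<in> measurable (M i) \<mu>"
    and em: "\<And>A. A \<in> sets \<mu> \<Longrightarrow> emeasure \<mu> A = (\<Sum>i\<in>I. w i * emeasure (M i) (X i -` A \<inter> space (M i)))"
    and g: "g \<in> borel_measurable \<mu>"
  shows "(\<integral>\<^sup>+x. g x \<partial>\<mu>) = (\<Sum>i\<in>I. w i * (\<integral>\<^sup>+x. g (X i x) \<partial>M i))"
  using g
proof (induction rule: borel_measurable_induct)
  case (cong f g)
  have "(\<integral>\<^sup>+x. f (X i x) \<partial>M i) = (\<integral>\<^sup>+x. g (X i x) \<partial>M i)" if "i \<in> I" for i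
    using cong(3) measurable_space[OF X[OF that]] by (intro nn_integral_cong) auto
  moreover have "(\<integral>\<^sup>+x. f x \<partial>\<mu>) = (\<integral>\<^sup>+x. g x \<partial>\<mu>)" using cong(3) by (intro nn_integral_cong) auto
  ultimately show ?case using cong by simp
next
  case (set A)
  have "(\<integral>\<^sup>+x. indicator A (X i x) \<partial>M i) = emeasure (M i) (X i -` A \<inter> space (M i))" if "i \<in> I" for i
  proof -
    have "(\<integral>\<^sup>+x. indicator A (X i x) \<partial>M i) = (\<integral>\<^sup>+x. indicator (X i -` A \<inter> space (M i)) x \<partial>M i)"
      by (intro nn_integral_cong) (auto simp: indicator_def)
    then show ?thesis using measurable_sets[OF X[OF that] set] by simp
  qed
  then show ?case using set em by simp
next
  case (mult u c)
  have "(\<integral>\<^sup>+x. c * u (X i x) \<partial>M i) = c * (\<integral>\<^sup>+x. u (X i x) \<partial>M i)" if "i \<in> I" for i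
    using mult X[OF that] by (intro nn_integral_cmult) auto
  then show ?case using mult by (simp add: nn_integral_cmult sum_distrib_left mult_ac)
next
  case (add u v)
  have "(\<integral>\<^sup>+x. v (X i x) + u (X i x) \<partial>M i) = (\<integral>\<^sup>+x. v (X i x) \<partial>M i) + (\<integral>\<^sup>+x. u (X i x) \<partial>M i)" if "i \<in> I" for i
    using add X[OF that] by (intro nn_integral_add) auto
  then show ?case using add by (simp add: nn_integral_add sum.distrib distrib_left)
next
  case (seq U)
  have meas: "(\<lambda>x. U n (X i x)) \<in> borel_measurable (M i)" if "i \<in> I" for i n
    using seq X[OF that] by auto
  have inc: "incseq (\<lambda>n x. U n (X i x))" for i
    using seq(3) by (auto simp: incseq_def le_fun_def)
  have mi: "(\<integral>\<^sup>+x. (SUP n. U n (X i x)) \<partial>M i) = (SUP n. \<integral>\<^sup>+x. U n (X i x) \<partial>M i)" if "i \<in> I" for i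
    using meas[OF that] inc by (intro nn_integral_monotone_convergence_SUP)
  have "(\<integral>\<^sup>+x. (SUP n. U n x) \<partial>\<mu>) = (SUP n. \<integral>\<^sup>+x. U n x \<partial>\<mu>)"
    using seq by (intro nn_integral_monotone_convergence_SUP)
  also have "\<dots> = (SUP n. \<Sum>i\<in>I. w i * (\<integral>\<^sup>+x. U n (X i x) \<partial>M i))"
    using seq by simp
  also have "\<dots> = (\<Sum>i\<in>I. SUP n. w i * (\<integral>\<^sup>+x. U n (X i x) \<partial>M i))"
    using seq(3) by (intro ennreal_SUP_sum) (auto simp: incseq_def le_fun_def intro!: mult_left_mono nn_integral_mono)
  also have "\<dots> = (\<Sum>i\<in>I. w i * (\<integral>\<^sup>+x. (SUP n. U n (X i x)) \<partial>M i))"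
    by (intro sum.cong) (auto simp: mi SUP_mult_left_ennreal)
  finally show ?case by (simp add: image_comp)
qed

lemma integral_mixture:
  fixes w :: "'i \<Rightarrow> real" and f :: "'b \<Rightarrow> real"
  assumes fin: "finite I" and X[measurable]: "\<And>i. i \<in> I \<Longrightarrow> X i \<in> measurable (M i) \<mu>"
    and em: "\<And>A. A \<in> sets \<mu> \<Longrightarrow>
      emeasure \<mu> A = (\<Sum>i\<in>I. ennreal (w i) * emeasure (M i) (X i -` A \<inter> space (M i)))"
    and M: "\<And>i. i \<in> I \<Longrightarrow> finite_measure (M i)" and w: "\<And>i. i \<in> I \<Longrightarrow> 0 \<le> w i"
    and f: "f \<in> borel_measurable \<mu>" and bd: "\<And>x. \<bar>f x\<bar> \<le> C"
  shows "(\<integral>x. f x \<partial>\<mu>) = (\<Sum>i\<in>I. w i * (\<integral>x. f (X i x) \<partial>M i))"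
proof -
  have fm: "(\<lambda>x. f (X i x)) \<in> borel_measurable (M i)" if "i \<in> I" for i
    using f X[OF that] by auto
  have nonneg: "(\<integral>x. g x \<partial>\<mu>) = (\<Sum>i\<in>I. w i * (\<integral>x. g (X i x) \<partial>M i))"
    if g: "g \<in> borel_measurable \<mu>" "\<And>x. 0 \<le> g x" "\<And>x. g x \<le> D" for g :: "'b \<Rightarrow> real" and D
  proof -
    have gm: "(\<lambda>x. g (X i x)) \<in> borel_measurable (M i)" if "i \<in> I" for i
      using g X[OF that] by auto
    have gi: "integrable (M i) (\<lambda>x. g (X i x))" if "i \<in> I" for i
    proof -
      interpret finite_measure "M i" using M that .
      show ?thesis using gm[OF that] g by (intro integrable_const_bound[where B=D]) auto
    qed
    have "(\<integral>\<^sup>+x. g x \<partial>\<mu>) = (\<Sum>i\<in>I. ennreal (w i) * (\<integral>\<^sup>+x. g (X i x) \<partial>M i))"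
      using g by (intro nn_integral_mixture[OF fin X em]) auto
    also have "\<dots> = (\<Sum>i\<in>I. ennreal (w i * (\<integral>x. g (X i x) \<partial>M i)))"
      using gi g by (intro sum.cong refl) (simp add: nn_integral_eq_integral ennreal_mult' w)
    also have "\<dots> = ennreal (\<Sum>i\<in>I. w i * (\<integral>x. g (X i x) \<partial>M i))"
      using w g by (intro sum_ennreal) auto
    finally have "(\<integral>\<^sup>+x. g x \<partial>\<mu>) = ennreal (\<Sum>i\<in>I. w i * (\<integral>x. g (X i x) \<partial>M i))" .
    then show ?thesis using g w
      by (subst integral_eq_nn_integral)
         (auto intro!: sum_nonneg enn2real_ennreal mult_nonneg_nonneg integral_nonneg_AE)
  qed
  have C: "0 \<le> C" using bd[of undefined] by linarith
  have 1: "(\<integral>x. max 0 (f x) \<partial>\<mu>) = (\<Sum>i\<in>I. w i * (\<integral>x. max 0 (f (X i x)) \<partial>M i))"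
    using f bd C by (intro nonneg[where D=C]) (auto simp: max_def abs_le_iff)
  have 2: "(\<integral>x. max 0 (- f x) \<partial>\<mu>) = (\<Sum>i\<in>I. w i * (\<integral>x. max 0 (- f (X i x)) \<partial>M i))"
    using f bd C by (intro nonneg[where D=C]) (auto simp: max_def abs_le_iff)
  \<comment> \<open>Stated for an arbitrary finite measure, since it serves for \<mu> as well as for
    each \<open>M i\<close>.\<close>
  have split: "(\<integral>x. h x \<partial>L) = (\<integral>x. max 0 (h x) \<partial>L) - (\<integral>x. max 0 (- h x) \<partial>L)"
    if "finite_measure L" "h \<in> borel_measurable L" "\<And>x. \<bar>h x\<bar> \<le> C" for h and L :: "'x measure"
  proof -
    interpret finite_measure L by fact
    have b: "max 0 (h x) \<le> C" "max 0 (- h x) \<le> C" for x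
      using that(3)[of x] C by (auto simp: max_def abs_le_iff)
    have i: "integrable L (\<lambda>x. max 0 (h x))" "integrable L (\<lambda>x. max 0 (- h x))"
      using that(2) b by (auto intro!: integrable_const_bound[where B=C])
    have "(\<integral>x. h x \<partial>L) = (\<integral>x. max 0 (h x) - max 0 (- h x) \<partial>L)"
      by (intro Bochner_Integration.integral_cong) (auto simp: max_def)
    then show ?thesis using i by simp
  qed
  have finmu: "finite_measure \<mu>"
  proof (rule finite_measureI)
    have *: "ennreal (w i) * emeasure (M i) (X i -` space \<mu> \<inter> space (M i)) < \<infinity>" if "i \<in> I" for i
      using finite_measure.emeasure_finite[OF M[OF that]]
      by (auto simp: ennreal_mult_less_top less_top)
    show "emeasure \<mu> (space \<mu>) \<noteq> \<infinity>"
      using em[OF sets.top] * fin by (simp add: less_top)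
  qed
  have "(\<integral>x. f x \<partial>\<mu>) = (\<Sum>i\<in>I. w i * (\<integral>x. max 0 (f (X i x)) \<partial>M i)) - (\<Sum>i\<in>I. w i * (\<integral>x. max 0 (- f (X i x)) \<partial>M i))"
    using split[OF finmu f bd] 1 2 by simp
  also have "\<dots> = (\<Sum>i\<in>I. w i * ((\<integral>x. max 0 (f (X i x)) \<partial>M i) - (\<integral>x. max 0 (- f (X i x)) \<partial>M i)))"
    by (simp add: sum_subtractf right_diff_distrib)
  also have "\<dots> = (\<Sum>i\<in>I. w i * (\<integral>x. f (X i x) \<partial>M i))"
    using split[OF M fm bd] by (intro sum.cong) auto
  finally show ?thesis .
qed

section \<open>Invariance of the Coulomb cost under relabelling of the particles\<close>

lemma finite_pairs: "finite {(i, j). 1 \<le> i \<and> i < j \<and> j \<le> (k::nat)}"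
  by (rule finite_subset[of _ "{1..k} \<times> {1..k}"]) auto

lemma coulomb_cong:
  assumes "\<And>i. i \<in> {1..k} \<Longrightarrow> x i = y i"
  shows "coulomb k x = coulomb k y"
  unfolding coulomb_def using assms by (intro sum.cong) auto

lemma coulomb_measurable:
  assumes X: "\<And>i. i \<in> {1..k} \<Longrightarrow> X i \<in> borel_measurable M"
  shows "(\<lambda>t. coulomb k (\<lambda>i. X i t)) \<in> borel_measurable M"
  unfolding coulomb_def
proof (rule borel_measurable_sum)
  fix p assume "p \<in> {(i, j). 1 \<le> i \<and> i < j \<and> j \<le> k}"
  then obtain i j where p: "p = (i, j)" "i \<in> {1..k}" "j \<in> {1..k}" by auto
  then show "(\<lambda>t. case p of (i, j) \<Rightarrow> 1 / ennreal (norm (X i t - X j t))) \<in> borel_measurable M"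
    using X[of i] X[of j] by simp
qed

lemma coulomb_measurable_config [measurable]: "coulomb k \<in> borel_measurable (config_space k)"
  using coulomb_measurable[where M="config_space k" and X="\<lambda>i x. x i" and k=k] by simp

text \<open>A relabelling does not respect the order \<open>i < j\<close>, but it permutes the
  ordered pairs of distinct indices. Doubling passes to such pairs, and the factor 2 can be
  cancelled afterwards in \<open>ennreal\<close>.\<close>

lemma sum_pairs_double:
  fixes h :: "nat \<Rightarrow> nat \<Rightarrow> ennreal"
  assumes "\<And>i j. h i j = h j i"
  shows "2 * (\<Sum>(i, j) \<in> {(i, j). 1 \<le> i \<and> i < j \<and> j \<le> k}. h i j) =
    (\<Sum>(i, j) \<in> {(i, j). i \<in> {1..k} \<and> j \<in> {1..k} \<and> i \<noteq> j}. h i j)"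
proof -
  let ?T = "{(i, j). 1 \<le> i \<and> i < j \<and> j \<le> k}"
  let ?h = "\<lambda>(i, j). h i j"
  have "(\<Sum>p \<in> prod.swap ` ?T. ?h p) = (\<Sum>p \<in> ?T. ?h (prod.swap p))"
    by (simp add: sum.reindex)
  also have "\<dots> = (\<Sum>p \<in> ?T. ?h p)"
    by (intro sum.cong) (auto simp: assms)
  finally have s: "(\<Sum>p \<in> prod.swap ` ?T. ?h p) = (\<Sum>p \<in> ?T. ?h p)" .
  have u: "{(i, j). i \<in> {1..k} \<and> j \<in> {1..k} \<and> i \<noteq> j} = ?T \<union> prod.swap ` ?T"
    by (auto simp: image_iff)
  have "(\<Sum>p \<in> ?T \<union> prod.swap ` ?T. ?h p) = (\<Sum>p \<in> ?T. ?h p) + (\<Sum>p \<in> prod.swap ` ?T. ?h p)"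
    by (intro sum.union_disjoint finite_pairs finite_imageI) auto
  then show ?thesis unfolding u s by (simp add: mult_2)
qed

lemma sum_offdiagonal_reindex:
  fixes h :: "nat \<Rightarrow> nat \<Rightarrow> ennreal"
  assumes "bij_betw \<sigma> A B"
  shows "(\<Sum>(i, j) \<in> {(i, j). i \<in> A \<and> j \<in> A \<and> i \<noteq> j}. h (\<sigma> i) (\<sigma> j)) =
    (\<Sum>(i, j) \<in> {(i, j). i \<in> B \<and> j \<in> B \<and> i \<noteq> j}. h i j)"
proof -
  let ?U = "{(i, j). i \<in> A \<and> j \<in> A \<and> i \<noteq> j}" and ?V = "{(i, j). i \<in> B \<and> j \<in> B \<and> i \<noteq> j}"
  have \<sigma>: "inj_on \<sigma> A" "\<And>i. i \<in> A \<Longrightarrow> \<sigma> i \<in> B" "\<sigma> ` A = B"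
    using assms bij_betwE by (auto simp: bij_betw_def)
  have "inj_on (map_prod \<sigma> \<sigma>) ?U"
    by (rule inj_on_subset[OF map_prod_inj_on[OF \<sigma>(1) \<sigma>(1)]]) auto
  moreover have "map_prod \<sigma> \<sigma> ` ?U = ?V"
  proof (intro equalityI subsetI)
    fix q assume "q \<in> map_prod \<sigma> \<sigma> ` ?U"
    then obtain i j where q: "q = (\<sigma> i, \<sigma> j)" and ij: "i \<in> A" "j \<in> A" "i \<noteq> j" by auto
    then have "\<sigma> i \<noteq> \<sigma> j" using inj_onD[OF \<sigma>(1)] by metis
    then show "q \<in> ?V" using q \<sigma>(2)[OF ij(1)] \<sigma>(2)[OF ij(2)] by simp
  next
    fix q assume q: "q \<in> ?V"
    then obtain i j where "i \<in> A" "j \<in> A" "q = (\<sigma> i, \<sigma> j)"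
      unfolding \<sigma>(3)[symmetric] by auto
    then show "q \<in> map_prod \<sigma> \<sigma> ` ?U" using q by (intro image_eqI[of _ _ "(i, j)"]) auto
  qed
  ultimately have "bij_betw (map_prod \<sigma> \<sigma>) ?U ?V"
    by (simp add: bij_betw_def)
  then show ?thesis
    by (subst sum.reindex_bij_betw[symmetric, where h="map_prod \<sigma> \<sigma>" and S="?U"])
       (auto simp: case_prod_unfold)
qed

lemma coulomb_double:
  "2 * coulomb k x = (\<Sum>(i, j) \<in> {(i, j). i \<in> {1..k} \<and> j \<in> {1..k} \<and> i \<noteq> j}. 1 / ennreal (norm (x i - x j)))"
  unfolding coulomb_def by (rule sum_pairs_double) (simp add: norm_minus_commute)

lemma coulomb_reindex:
  assumes "bij_betw \<sigma> {1..k} {1..k}"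
  shows "coulomb k (\<lambda>i. x (\<sigma> i)) = coulomb k x"
proof -
  have "2 * coulomb k (\<lambda>i. x (\<sigma> i)) = 2 * coulomb k x"
    unfolding coulomb_double
    by (rule sum_offdiagonal_reindex[OF assms, where h="\<lambda>i j. 1 / ennreal (norm (x i - x j))"])
  then show ?thesis by (simp add: ennreal_mult_cancel_left)
qed

text \<open>The first part fixes the shift: it is a permutation, so it preserves the cost. The
  second part fixes the position and varies the shift: every particle visits this position exactly
  once, so averaging over the shifts gives all positions the same law.\<close>

lemma cyclic_shift_bij:
  fixes k r :: nat
  shows "bij_betw (\<lambda>j. (j + r) mod k + 1) {1..k} {1..k}"
    and "bij_betw (\<lambda>s. (r + s) mod k + 1) {..<k} {1..k}"
proof -
  have less: False if "(x + r) mod k = (y + r) mod k" "x < y" "y < x + k" for x y :: nat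
  proof -
    have "k dvd (y + r) - (x + r)"
      using that(1,2) by (subst mod_eq_dvd_iff_nat[symmetric]) auto
    then have "k dvd y - x" by simp
    then show False using that(2,3) by (auto dest!: dvd_imp_le)
  qed
  have inj: "x = y" if "(x + r) mod k = (y + r) mod k" "x < y + k" "y < x + k" for x y :: nat
    using less[of x y] less[of y x] that by (metis linorder_neqE_nat)
  have 1: "inj_on (\<lambda>j. (j + r) mod k + 1) {1..k}"
    by (auto simp: inj_on_def intro!: inj)
  have 2: "inj_on (\<lambda>s. (r + s) mod k + 1) {..<k}"
    by (auto simp: inj_on_def add.commute[of r] intro!: inj)
  have i1: "(\<lambda>j. (j + r) mod k + 1) ` {1..k} \<subseteq> {1..k}"
    by (auto simp: Suc_le_eq)
  have i2: "(\<lambda>s. (r + s) mod k + 1) ` {..<k} \<subseteq> {1..k}"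
    by (auto simp: Suc_le_eq)
  show "bij_betw (\<lambda>j. (j + r) mod k + 1) {1..k} {1..k}"
    using 1 i1 by (simp add: bij_betw_def endo_inj_surj)
  show "bij_betw (\<lambda>s. (r + s) mod k + 1) {..<k} {1..k}"
    using 2 i2 by (metis bij_betw_def card_atLeastAtMost card_image card_lessThan card_subset_eq
        diff_Suc_1 finite_atLeastAtMost)
qed

text \<open>Averaging over cyclic shifts alone already equalizes the marginals.\<close>

lemma cyclic_symmetrization:
  fixes X :: "nat \<Rightarrow> 'a \<Rightarrow> real ^ 'd"
  assumes k: "1 \<le> k" and X: "\<And>i. i \<in> {1..k} \<Longrightarrow> X i \<in> borel_measurable M"
  obtains P \<mu> where "sets \<mu> = sets borel" "P \<in> couplings k \<mu>"
    "\<And>A. A \<in> sets borel \<Longrightarrow>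
       emeasure \<mu> A = (\<Sum>i=1..k. ennreal (1 / real k) * emeasure M (X i -` A \<inter> space M))"
    "(\<integral>\<^sup>+x. coulomb k x \<partial>P) = (\<integral>\<^sup>+t. coulomb k (\<lambda>i. X i t) \<partial>M)"
proof -
  define \<sigma> where "\<sigma> r j = (j + r) mod k + 1" for r j
  define Z where "Z r t = (\<lambda>j\<in>{1..k}. X (\<sigma> r j) t)" for r t
  have \<sigma>: "\<sigma> r j \<in> {1..k}" for r j using k by (auto simp: \<sigma>_def Suc_le_eq)
  have Z: "Z r \<in> measurable M (config_space k)" for r
    unfolding Z_def by (intro measurable_restrict X \<sigma>)
  have "\<exists>P. sets P = sets (config_space k) \<and> (\<forall>A\<in>sets (config_space k).
      emeasure P A = (\<Sum>r<k. ennreal (1 / real k) * emeasure M (Z r -` A \<inter> space M)))"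
    by (rule mixture_exists[OF finite_lessThan Z])
  then obtain P where P: "sets P = sets (config_space k)"
    "\<And>A. A \<in> sets (config_space k) \<Longrightarrow>
      emeasure P A = (\<Sum>r<k. ennreal (1 / real k) * emeasure M (Z r -` A \<inter> space M))"
    by metis
  have Z': "Z r \<in> measurable M P" for r
    using Z[of r] unfolding measurable_cong_sets[OF refl P(1)] .
  define \<mu> where "\<mu> = distr P borel (\<lambda>x. x 1)"
  have comp: "(\<lambda>x. x j) \<in> measurable P borel" if "j \<in> {1..k}" for j
    unfolding measurable_cong_sets[OF P(1) refl] using that by (rule measurable_component_singleton)
  have marg: "emeasure (distr P borel (\<lambda>x. x j)) A =
      (\<Sum>i=1..k. ennreal (1 / real k) * emeasure M (X i -` A \<inter> space M))"
    if j: "j \<in> {1..k}" and A: "A \<in> sets borel" for j A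
  proof -
    have sp: "space P = space (config_space k)" using P(1) by (rule sets_eq_imp_space_eq)
    have S: "(\<lambda>x. x j) -` A \<inter> space P \<in> sets (config_space k)"
      using measurable_sets[OF comp[OF j] A] P(1) by simp
    have pre: "Z r -` ((\<lambda>x. x j) -` A \<inter> space P) \<inter> space M = X (\<sigma> r j) -` A \<inter> space M" for r
      using measurable_space[OF Z'[of r]] j by (auto simp: Z_def)
    have "emeasure (distr P borel (\<lambda>x. x j)) A = emeasure P ((\<lambda>x. x j) -` A \<inter> space P)"
      using comp[OF j] A by (rule emeasure_distr)
    also have "\<dots> = (\<Sum>r<k. ennreal (1 / real k) * emeasure M (X (\<sigma> r j) -` A \<inter> space M))"
      unfolding P(2)[OF S] pre ..
    also have "\<dots> = (\<Sum>i=1..k. ennreal (1 / real k) * emeasure M (X i -` A \<inter> space M))"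
      using sum.reindex_bij_betw[OF cyclic_shift_bij(2)[of j k],
        where g="\<lambda>i. ennreal (1 / real k) * emeasure M (X i -` A \<inter> space M)"]
      by (simp add: \<sigma>_def)
    finally show ?thesis .
  qed
  have coup: "P \<in> couplings k \<mu>"
    unfolding couplings_def \<mu>_def using P(1) marg k by (auto intro!: measure_eqI)
  have "(\<integral>\<^sup>+x. coulomb k x \<partial>P) = (\<Sum>r<k. ennreal (1 / real k) * (\<integral>\<^sup>+t. coulomb k (Z r t) \<partial>M))"
  proof (rule nn_integral_mixture[OF finite_lessThan Z'])
    show "coulomb k \<in> borel_measurable P"
      unfolding measurable_cong_sets[OF P(1) refl] by (rule coulomb_measurable_config)
  qed (use P in auto)
  also have "\<dots> = (\<Sum>r<k. ennreal (1 / real k) * (\<integral>\<^sup>+t. coulomb k (\<lambda>i. X i t) \<partial>M))"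
  proof -
    have "coulomb k (Z r t) = coulomb k (\<lambda>i. X i t)" for r t
    proof -
      have "coulomb k (Z r t) = coulomb k (\<lambda>j. X (\<sigma> r j) t)"
        by (rule coulomb_cong) (simp add: Z_def)
      also have "\<dots> = coulomb k (\<lambda>i. X i t)"
        unfolding \<sigma>_def by (rule coulomb_reindex[OF cyclic_shift_bij(1)])
      finally show ?thesis .
    qed
    then show ?thesis by simp
  qed
  also have "\<dots> = (ennreal (real k) * ennreal (1 / real k)) * (\<integral>\<^sup>+t. coulomb k (\<lambda>i. X i t) \<partial>M)"
    by (simp add: mult.assoc ennreal_of_nat_eq_real_of_nat)
  also have "\<dots> = (\<integral>\<^sup>+t. coulomb k (\<lambda>i. X i t) \<partial>M)"
    using k by (simp flip: ennreal_mult')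
  finally show ?thesis
    using that[of \<mu> P] coup marg[of 1] k by (simp add: \<mu>_def)
qed

section \<open>Encoding configurations by a space-filling curve\<close>

text \<open>A continuous function of period 2 that vanishes on \<open>[0, 1/3]\<close> and is 1 on \<open>[2/3, 1]\<close>, so that
  \<open>wave (3 ^ m * t)\<close> recovers the \<open>m\<close>-th ternary digit of a point \<open>t\<close> of the Cantor set.\<close>

definition wave :: "real \<Rightarrow> real" where
  "wave u = max 0 (min 1 (1/2 - cos (pi * u)))"

lemma wave_bounds: "0 \<le> wave u" "wave u \<le> 1"
  by (auto simp: wave_def)

lemma wave_periodic: "wave (2 * of_int n + u) = wave u"
proof -
  have "cos (pi * (2 * of_int n + u)) = cos (2 * pi * of_int n + pi * u)"
    by (simp add: algebra_simps)
  also have "\<dots> = cos (pi * u)"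
    by (simp add: cos_add)
  finally show ?thesis by (simp add: wave_def)
qed

text \<open>\<open>cos (pi * u)\<close> is at least 1/2 on [0, 1/3] and at most -1/2 on [2/3, 1], so
  \<open>1/2 - cos (pi * u)\<close> is clamped to 0 and to 1 there. The remainder
  \<open>s / 3\<close> stands for all ternary digits after the first.\<close>

lemma wave_digit:
  assumes "a \<in> {0, 1}" "0 \<le> s" "s \<le> 1"
  shows "wave (2 * a / 3 + s / 3) = a"
proof (cases "a = 0")
  case True
  have "pi * (s / 3) \<le> pi / 3" using assms by simp
  then have "cos (pi / 3) \<le> cos (pi * (s / 3))"
    using assms by (intro cos_monotone_0_pi_le) auto
  then show ?thesis using True by (simp add: wave_def cos_60)
next
  case False
  then have a: "a = 1" using assms by simp
  have l: "pi - pi / 3 \<le> pi * (2 / 3 + s / 3)" using assms by (simp add: algebra_simps)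
  have "pi * (2 / 3 + s / 3) \<le> pi * 1" using assms by (intro mult_left_mono) auto
  then have u: "pi * (2 / 3 + s / 3) \<le> pi" by simp
  have "cos (pi * (2 / 3 + s / 3)) \<le> cos (pi - pi / 3)"
    using l u by (intro cos_monotone_0_pi_le) auto
  also have "\<dots> = - (1/2)" by (simp only: cos_pi_minus cos_60)
  finally show ?thesis using a by (simp add: wave_def)
qed

definition ternary :: "(nat \<Rightarrow> real) \<Rightarrow> real" where
  "ternary a = (\<Sum>l. 2 * a l / 3 ^ Suc l)"

lemma ternary_summable:
  assumes "\<And>l. a l \<in> {0, 1::real}"
  shows "summable (\<lambda>l. 2 * a l / 3 ^ Suc l)"
proof (rule summable_comparison_test')
  show "summable (\<lambda>l. 2 / 3 * (1/3::real) ^ l)" by (intro summable_mult summable_geometric) auto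
  fix n show "norm (2 * a n / 3 ^ Suc n) \<le> 2 / 3 * (1/3::real) ^ n"
    using assms[of n] by (auto simp: power_one_over)
qed

lemma ternary_bounds:
  assumes "\<And>l. a l \<in> {0, 1::real}"
  shows "0 \<le> ternary a" "ternary a \<le> 1"
proof -
  have a: "0 \<le> a l" "a l \<le> 1" for l using assms[of l] by auto
  show "0 \<le> ternary a" unfolding ternary_def
    using a by (intro suminf_nonneg ternary_summable assms) auto
  have s: "(\<lambda>l. 2 / 3 * (1/3::real) ^ l) sums (2 / 3 * (1 / (1 - 1/3)))"
    by (intro sums_mult geometric_sums) auto
  have "ternary a \<le> (\<Sum>l. 2 / 3 * (1/3::real) ^ l)"
    unfolding ternary_def using a s
    by (intro suminf_le ternary_summable assms) (auto simp: power_one_over sums_iff field_simps)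
  then show "ternary a \<le> 1" using s by (simp add: sums_iff)
qed

lemma ternary_shift:
  assumes "\<And>l. a l \<in> {0, 1::real}"
  shows "ternary a = 2 * a 0 / 3 + ternary (\<lambda>l. a (Suc l)) / 3"
proof -
  have "ternary (\<lambda>l. a (Suc l)) / 3 = (\<Sum>l. 2 * a (Suc l) / 3 ^ Suc (Suc l))"
    unfolding ternary_def
    using suminf_divide[OF ternary_summable[of "\<lambda>l. a (Suc l)", OF assms], of 3] by (simp add: mult_ac)
  also have "\<dots> = ternary a - 2 * a 0 / 3"
    unfolding ternary_def using suminf_split_head[OF ternary_summable[of a, OF assms]] by simp
  finally show ?thesis by (simp add: field_simps)
qed

text \<open>After multiplication by a positive power of 3, the leading digit, doubled in the Cantor
  expansion, contributes an even integer, which the period 2 of \<open>wave\<close> forgets. The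
  induction peels off this digit and hence generalizes over \<open>a\<close>.\<close>

lemma wave_ternary:
  assumes "\<And>l. a l \<in> {0, 1::real}"
  shows "wave (3 ^ m * ternary a) = a m"
  using assms
proof (induction m arbitrary: a)
  case 0
  then show ?case using ternary_shift[of a] wave_digit[of "a 0" "ternary (\<lambda>l. a (Suc l))"]
      ternary_bounds[of "\<lambda>l. a (Suc l)"] by simp
next
  case (Suc m)
  define n :: int where "n = (if a 0 = 1 then 3 ^ m else 0)"
  have n: "of_int n = 3 ^ m * a 0" using Suc.prems[of 0] by (auto simp: n_def)
  have "3 ^ Suc m * ternary a = 2 * (3 ^ m * a 0) + 3 ^ m * ternary (\<lambda>l. a (Suc l))"
    unfolding ternary_shift[of a, OF Suc.prems] by (simp add: algebra_simps)
  then have "wave (3 ^ Suc m * ternary a) = wave (3 ^ m * ternary (\<lambda>l. a (Suc l)))"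
    using wave_periodic[of n] n by simp
  then show ?case using Suc.IH[of "\<lambda>l. a (Suc l)"] Suc.prems by simp
qed

section \<open>Binary digits and the space-filling curve\<close>

definition bit_of :: "real \<Rightarrow> nat \<Rightarrow> real" where
  "bit_of x k = real_of_int (\<lfloor>2 ^ Suc k * x\<rfloor> mod 2)"

lemma bit_of_01: "bit_of x k \<in> {0, 1}"
proof -
  have "\<lfloor>2 ^ Suc k * x\<rfloor> mod 2 = 0 \<or> \<lfloor>2 ^ Suc k * x\<rfloor> mod 2 = 1" by presburger
  then show ?thesis unfolding bit_of_def by (auto simp del: power_Suc)
qed

lemma bit_of_measurable [measurable]: "(\<lambda>x. bit_of x k) \<in> borel_measurable borel"
  unfolding bit_of_def by measurable

text \<open>The partial sums are the dyadic truncations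
  \<open>\<lfloor>2 ^ n * x\<rfloor> / 2 ^ n\<close>. At x = 1 all these bits are 0, whence the
  strict upper bound.\<close>

lemma binary_expansion:
  assumes "0 \<le> x" "x < 1"
  shows "(\<lambda>k. bit_of x k / 2 ^ Suc k) sums x"
proof -
  have part: "(\<Sum>k<n. bit_of x k / 2 ^ Suc k) = \<lfloor>2 ^ n * x\<rfloor> / 2 ^ n" for n
  proof (induction n)
    case 0
    then show ?case using assms by (simp add: floor_eq_iff)
  next
    case (Suc n)
    have "\<lfloor>2 ^ n * x\<rfloor> = \<lfloor>(2 ^ Suc n * x) / real_of_int 2\<rfloor>" by simp
    also have "\<dots> = \<lfloor>2 ^ Suc n * x\<rfloor> div 2" by (rule floor_divide_real_eq_div) simp
    finally have "\<lfloor>2 ^ Suc n * x\<rfloor> = 2 * \<lfloor>2 ^ n * x\<rfloor> + \<lfloor>2 ^ Suc n * x\<rfloor> mod 2"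
      by (metis mult_div_mod_eq)
    then have "real_of_int \<lfloor>2 ^ Suc n * x\<rfloor> = 2 * \<lfloor>2 ^ n * x\<rfloor> + bit_of x n"
      unfolding bit_of_def by linarith
    then show ?case using Suc by (simp add: field_simps)
  qed
  have "(\<lambda>n. x - (1/2) ^ n) \<longlonglongrightarrow> x - 0"
    by (intro tendsto_intros LIMSEQ_power_zero) auto
  then have lo: "(\<lambda>n. x - (1/2) ^ n) \<longlonglongrightarrow> x" by simp
  have "(\<lambda>n. \<lfloor>2 ^ n * x\<rfloor> / 2 ^ n) \<longlonglongrightarrow> x"
  proof (rule tendsto_sandwich[OF _ _ lo tendsto_const])
    have "x - (1/2) ^ n \<le> \<lfloor>2 ^ n * x\<rfloor> / 2 ^ n" for n
    proof -
      have "2 ^ n * x - 1 \<le> \<lfloor>2 ^ n * x\<rfloor>" by linarith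
      then have "(2 ^ n * x - 1) / 2 ^ n \<le> \<lfloor>2 ^ n * x\<rfloor> / 2 ^ n" by (rule divide_right_mono) simp
      then show ?thesis by (simp add: diff_divide_distrib power_one_over)
    qed
    then show "\<forall>\<^sub>F n in sequentially. x - (1/2) ^ n \<le> \<lfloor>2 ^ n * x\<rfloor> / 2 ^ n" by simp
    have "\<lfloor>2 ^ n * x\<rfloor> / 2 ^ n \<le> x" for n
    proof -
      have "\<lfloor>2 ^ n * x\<rfloor> \<le> 2 ^ n * x" by linarith
      then have "\<lfloor>2 ^ n * x\<rfloor> / 2 ^ n \<le> (2 ^ n * x) / 2 ^ n" by (rule divide_right_mono) simp
      then show ?thesis by simp
    qed
    then show "\<forall>\<^sub>F n in sequentially. \<lfloor>2 ^ n * x\<rfloor> / 2 ^ n \<le> x" by simp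
  qed
  then show ?thesis unfolding sums_def part .
qed

text \<open>\<open>prod_encode\<close> allots to each coordinate \<open>j\<close> its own infinite
  set of ternary digits of \<open>t\<close>, which are reread as binary digits. This is Schoenberg's
  curve with countably many coordinates.\<close>

definition schoenberg :: "nat \<Rightarrow> real \<Rightarrow> real" where
  "schoenberg j t = (\<Sum>k. wave (3 ^ prod_encode (j, k) * t) / 2 ^ Suc k)"

lemma schoenberg_continuous: "continuous_on UNIV (schoenberg j)"
proof -
  have "uniform_limit UNIV (\<lambda>n t. \<Sum>k<n. wave (3 ^ prod_encode (j, k) * t) / 2 ^ Suc k)
    (\<lambda>t. \<Sum>k. wave (3 ^ prod_encode (j, k) * t) / 2 ^ Suc k) sequentially"
  proof (rule Weierstrass_m_test)
    show "summable (\<lambda>k. 1 / 2 * (1 / 2 :: real) ^ k)" by (intro summable_mult summable_geometric) auto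
    fix n :: nat and t :: real
    show "norm (wave (3 ^ prod_encode (j, n) * t) / 2 ^ Suc n) \<le> 1 / 2 * (1 / 2) ^ n"
      using wave_bounds by (simp add: power_one_over divide_right_mono)
  qed
  then show ?thesis unfolding schoenberg_def
    by (rule uniform_limit_theorem[rotated])
       (auto simp: wave_def intro!: always_eventually continuous_intros)
qed

text \<open>The section: the bits of all coordinates are interleaved into the digits of a single
  point of the Cantor set. Bits jump at dyadic numbers, so this map is Borel but not
  continuous.\<close>

definition lift_code :: "(nat \<Rightarrow> real) \<Rightarrow> real" where
  "lift_code x = ternary (\<lambda>m. bit_of (x (fst (prod_decode m))) (snd (prod_decode m)))"

lemma lift_code_bounds: "lift_code x \<in> {0..1}"
  unfolding lift_code_def using ternary_bounds bit_of_01 by auto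

lemma schoenberg_lift_code:
  assumes "0 \<le> x j" "x j < 1"
  shows "schoenberg j (lift_code x) = x j"
  using binary_expansion[OF assms]
  by (simp add: schoenberg_def lift_code_def wave_ternary[OF bit_of_01] sums_iff del: power_Suc)

lemma lift_code_measurable:
  assumes [measurable]: "\<And>j. (\<lambda>\<omega>. x \<omega> j) \<in> borel_measurable M"
  shows "(\<lambda>\<omega>. lift_code (x \<omega>)) \<in> borel_measurable M"
  unfolding lift_code_def ternary_def
  by (intro borel_measurable_suminf borel_measurable_divide borel_measurable_times
      measurable_compose[OF assms bit_of_measurable]) auto

text \<open>Rescaling from [0, 1] to [-1, 1] makes each particle range over a cube rather than the
  closed unit ball. For this reason \<open>ball_ext\<close> and \<open>kern\<close> are defined on
  the whole space and treat every point of norm at least 1 as infinity.\<close>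

definition curve :: "nat \<Rightarrow> real \<Rightarrow> real ^ 'd" where
  "curve i t = (\<chi> c. 2 * schoenberg (to_nat (i, c)) t - 1)"

lemma curve_continuous: "continuous_on UNIV (curve i)"
  unfolding curve_def
  by (intro continuous_on_vec_lambda continuous_intros schoenberg_continuous)

lemma curve_lift:
  fixes Z :: "nat \<Rightarrow> 'a \<Rightarrow> real ^ 'd"
  assumes Z[measurable]: "\<And>i. Z i \<in> borel_measurable M" and bd: "\<And>i \<omega>. norm (Z i \<omega>) < 1"
  obtains \<tau> where "\<tau> \<in> borel_measurable M" "\<And>\<omega>. \<tau> \<omega> \<in> {0..1::real}"
    "\<And>i \<omega>. curve i (\<tau> \<omega>) = Z i \<omega>"
proof -
  define x where "x \<omega> j = (case from_nat j :: nat \<times> 'd of (i, c) \<Rightarrow> (Z i \<omega> $ c + 1) / 2)" for \<omega> j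
  have "(\<lambda>\<omega>. x \<omega> j) \<in> borel_measurable M" for j
    unfolding x_def
    by (cases "from_nat j :: nat \<times> 'd")
       (auto intro!: measurable_compose[OF Z] borel_measurable_continuous_onI continuous_intros)
  then have m: "(\<lambda>\<omega>. lift_code (x \<omega>)) \<in> borel_measurable M" by (rule lift_code_measurable)
  \<comment> \<open>The strict bound on the norm keeps the rescaled coordinates below 1, as
    \<open>schoenberg_lift_code\<close> requires.\<close>
  have x01: "0 \<le> x \<omega> j" "x \<omega> j < 1" for \<omega> j
  proof -
    obtain i c where ic: "(from_nat j :: nat \<times> 'd) = (i, c)" by (cases "from_nat j :: nat \<times> 'd")
    have "\<bar>Z i \<omega> $ c\<bar> < 1" using component_le_norm_cart[of "Z i \<omega>" c] bd[of i \<omega>] by linarith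
    then show "0 \<le> x \<omega> j" "x \<omega> j < 1" by (auto simp: x_def ic)
  qed
  have "curve i (lift_code (x \<omega>)) = Z i \<omega>" for i \<omega>
    using schoenberg_lift_code[OF x01] by (simp add: curve_def vec_eq_iff) (simp add: x_def field_simps)
  then show ?thesis using that m lift_code_bounds by blast
qed

text \<open>Tightness yields the subsequence. The limit stays on [0, 1] because the truncated
  distance to [0, 1] is a bounded continuous test function whose integral is 0 along the
  sequence.\<close>

lemma unit_interval_compact:
  assumes Q: "\<And>n. real_distribution (Q n)" and supp: "\<And>n. emeasure (Q n) (- {0..1}) = 0"
  obtains r R where "strict_mono (r :: nat \<Rightarrow> nat)" "real_distribution R" "emeasure R (- {0..1}) = 0"
    "\<And>(f :: real \<Rightarrow> real) C. continuous_on UNIV f \<Longrightarrow> (\<And>t. \<bar>f t\<bar> \<le> C) \<Longrightarrow>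
      (\<lambda>n. \<integral>t. f t \<partial>Q (r n)) \<longlonglongrightarrow> (\<integral>t. f t \<partial>R)"
proof -
  have meas1: "measure (Q n) {-1<..1} = 1" for n
  proof -
    interpret real_distribution "Q n" by (rule Q)
    have "emeasure (Q n) (- {0..1}) = 0" by (rule supp)
    then have "AE t in Q n. t \<in> {0..1}" by (intro AE_I[of _ _ "- {0..1}"]) auto
    then have "AE t in Q n. t \<in> {-1<..1}" by (rule AE_mp) auto
    then show ?thesis by (subst prob_eq_1) auto
  qed
  \<comment> \<open>Tightness uses intervals \<open>{a<..b}\<close>, open on the left; the end point
    -1 keeps a possible atom at 0 inside.\<close>
  have "tight Q" unfolding tight_def using Q meas1
    by (intro conjI allI impI exI[of _ "-1::real"] exI[of _ "1::real"]) auto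
  then obtain r R where r: "strict_mono (r :: nat \<Rightarrow> nat)" "real_distribution R"
    and w: "weak_conv_m (Q \<circ> id \<circ> r) R"
    using tight_imp_convergent_subsubsequence[of Q id] by (auto simp: strict_mono_def)
  have conv: "(\<lambda>n. \<integral>t. f t \<partial>Q (r n)) \<longlonglongrightarrow> (\<integral>t. f t \<partial>R)"
    if "continuous_on UNIV f" "\<And>t. \<bar>f t\<bar> \<le> C" for f :: "real \<Rightarrow> real" and C
    using weak_conv_imp_integral_bdd_continuous_conv[where \<mu>="Q \<circ> id \<circ> r" and M=R and f=f and B=C] Q r w that
    by (auto simp: continuous_on_eq_continuous_at)
  define g where "g t = min 1 (infdist t {0..1::real})" for t
  have "0 \<le> g t \<and> g t \<le> 1" for t by (auto simp: g_def infdist_nonneg)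
  then have gb: "\<bar>g t\<bar> \<le> 1" "0 \<le> g t" for t by (auto simp: abs_le_iff intro: order_trans[of _ 0])
  have gc: "continuous_on UNIV g" unfolding g_def by (intro continuous_intros)
  have "(\<integral>t. g t \<partial>Q n) = 0" for n
  proof -
    interpret real_distribution "Q n" by (rule Q)
    have "AE t in Q n. t \<in> {0..1}" using supp[of n] by (intro AE_I[of _ _ "- {0..1}"]) auto
    then have "AE t in Q n. g t = 0" by (rule AE_mp) (auto simp: g_def)
    then show ?thesis by (simp add: integral_eq_zero_AE)
  qed
  then have "(\<integral>t. g t \<partial>R) = 0"
    using conv[OF gc gb(1)] LIMSEQ_unique[OF tendsto_const] by fastforce
  moreover interpret R: real_distribution R by (rule r)
  have "integrable R g"
    using gb borel_measurable_continuous_onI[OF gc] by (intro R.integrable_const_bound[where B=1]) auto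
  ultimately have "AE t in R. g t = 0"
    using gb by (subst (asm) integral_nonneg_eq_0_iff_AE) auto
  then have "AE t in R. t \<in> {0..1}"
  proof (rule AE_mp, intro AE_I2 impI)
    fix t assume "g t = 0"
    then have "infdist t {0..1} = 0" by (auto simp: g_def min_def split: if_splits)
    then show "t \<in> {0..1}" by (subst in_closed_iff_infdist_zero) auto
  qed
  then have "emeasure R (- {0..1}) = 0"
    by (subst (asm) AE_iff_measurable[OF _ refl]) (auto simp: Compl_eq)
  then show ?thesis using that r conv by blast
qed

section \<open>Compactification and lower semicontinuity\<close>

definition squash :: "real ^ 'd \<Rightarrow> real ^ 'd" where
  "squash x = inverse (1 + norm x) *\<^sub>R x"

definition unsquash :: "real ^ 'd \<Rightarrow> real ^ 'd" where
  "unsquash y = inverse (1 - norm y) *\<^sub>R y"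

lemma norm_squash: "norm (squash x) = norm x / (1 + norm x)"
  by (simp add: squash_def divide_inverse mult.commute)

lemma norm_squash_less: "norm (squash x) < 1"
  unfolding norm_squash by (simp add: divide_less_eq add_pos_nonneg)

lemma unsquash_squash: "unsquash (squash x) = x"
proof -
  have "1 + norm x > 0" by (simp add: add_pos_nonneg)
  then have "1 - norm (squash x) = inverse (1 + norm x)"
    unfolding norm_squash by (simp add: field_simps)
  then show ?thesis using \<open>1 + norm x > 0\<close> by (simp add: unsquash_def) (simp add: squash_def)
qed

lemma squash_measurable [measurable]: "squash \<in> borel_measurable borel"
  unfolding squash_def by measurable

lemma unsquash_measurable [measurable]: "unsquash \<in> borel_measurable borel"
  unfolding unsquash_def by measurable

definition ball_ext :: "(real ^ 'd \<Rightarrow> real) \<Rightarrow> real ^ 'd \<Rightarrow> real" where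
  "ball_ext f y = (if norm y < 1 then f (unsquash y) else 0)"

lemma ball_ext_squash: "ball_ext f (squash x) = f x"
  by (simp add: ball_ext_def norm_squash_less unsquash_squash)

text \<open>Vanishing at infinity is what glues \<open>f\<close> composed with
  \<open>unsquash\<close> continuously to 0 across the unit sphere. Thus functions in
  \<open>C0_functions\<close> become continuous test functions that ignore the mass at
  infinity.\<close>

lemma ball_ext_continuous:
  assumes "f \<in> C0_functions"
  shows "continuous_on UNIV (ball_ext f)"
proof -
  have fc: "continuous_on UNIV f" and f0: "(f \<longlongrightarrow> 0) at_infinity"
    using assms by (auto simp: C0_functions_def)
  have "isCont (ball_ext f) y" for y
  proof (cases "norm y < 1")
    case True
    have "isCont unsquash y"
      unfolding unsquash_def using True by (intro continuous_intros) auto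
    moreover have "isCont f (unsquash y)" using fc by (simp add: continuous_on_eq_continuous_at)
    ultimately have c: "isCont (\<lambda>y. f (unsquash y)) y" by (rule isCont_o2)
    have "open {y :: real ^ 'a. norm y < 1}"
      by (intro open_Collect_less continuous_intros)
    then have "\<forall>\<^sub>F z in nhds y. z \<in> {y. norm y < 1}" using True by (intro eventually_nhds_in_open) auto
    then have "\<forall>\<^sub>F z in nhds y. f (unsquash z) = ball_ext f z"
      by (rule eventually_mono) (simp add: ball_ext_def)
    then show ?thesis using c by (simp add: isCont_cong)
  next
    case False
    have "(ball_ext f \<longlongrightarrow> 0) (at y)"
    proof (rule tendstoI)
      fix e :: real assume e: "e > 0"
      have "\<exists>b. \<forall>x. b \<le> norm x \<longrightarrow> dist (f x) 0 < e"
        using tendstoD[OF f0 e] by (simp only: eventually_at_infinity)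
      then obtain b where "\<forall>x. b \<le> norm x \<longrightarrow> dist (f x) 0 < e" ..
      then have b: "\<bar>f x\<bar> < e" if "b \<le> norm x" for x using that by simp
      define B where "B = max b 0"
      have B: "0 \<le> B" "b \<le> B" by (auto simp: B_def)
      \<comment> \<open>\<open>B / (1 + B)\<close> is the norm of a squashed point of norm
        \<open>B\<close>. Beyond this radius, inside the ball, \<open>unsquash\<close> has norm at
        least \<open>B\<close>, where \<bar>f\<bar> is below \<open>e\<close>.\<close>
      then have "B / (1 + B) < 1" by simp
      then have "B / (1 + B) < norm y" using False by linarith
      moreover have "open {z :: real ^ 'a. B / (1 + B) < norm z}"
        by (intro open_Collect_less continuous_intros)
      ultimately have "\<forall>\<^sub>F z in nhds y. z \<in> {z. B / (1 + B) < norm z}"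
        by (intro eventually_nhds_in_open) auto
      then have "\<forall>\<^sub>F z in nhds y. dist (ball_ext f z) 0 < e"
      proof (rule eventually_mono)
        fix z :: "real ^ 'a" assume "z \<in> {z. B / (1 + B) < norm z}"
        then have z: "B / (1 + B) < norm z" by simp
        show "dist (ball_ext f z) 0 < e"
        proof (cases "norm z < 1")
          case True
          have "B \<le> norm z / (1 - norm z)"
            using z True B by (simp add: field_simps)
          then have "B \<le> norm (unsquash z)"
            using True by (simp add: unsquash_def divide_inverse mult.commute)
          then have "\<bar>f (unsquash z)\<bar> < e" using b B by simp
          then show ?thesis using True by (simp add: ball_ext_def)
        qed (use e in \<open>simp add: ball_ext_def\<close>)
      qed
      then show "\<forall>\<^sub>F z in at y. dist (ball_ext f z) 0 < e"
        by (simp add: eventually_at_filter eventually_mono)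
    qed
    then show ?thesis using False by (simp add: isCont_def ball_ext_def)
  qed
  then show ?thesis by (simp add: continuous_on_eq_continuous_at)
qed

lemma C0_bounded:
  assumes "f \<in> C0_functions"
  obtains C where "\<And>x. \<bar>f x\<bar> \<le> C"
proof -
  have fc: "continuous_on UNIV f" and f0: "(f \<longlongrightarrow> 0) at_infinity"
    using assms by (auto simp: C0_functions_def)
  have "\<exists>b. \<forall>x. b \<le> norm x \<longrightarrow> dist (f x) 0 < 1"
    using tendstoD[OF f0 zero_less_one] by (simp only: eventually_at_infinity)
  then obtain b where "\<forall>x. b \<le> norm x \<longrightarrow> dist (f x) 0 < 1" ..
  then have b: "\<bar>f x\<bar> < 1" if "b \<le> norm x" for x using that by simp
  have "compact (f ` cball 0 b)"
    by (intro compact_continuous_image continuous_on_subset[OF fc]) auto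
  then have "\<exists>D. \<forall>v\<in>f ` cball 0 b. norm v \<le> D"
    by (simp only: compact_imp_bounded bounded_iff[symmetric])
  then obtain D where "\<forall>v\<in>f ` cball 0 b. norm v \<le> D" ..
  then have D: "\<bar>f x\<bar> \<le> D" if "norm x \<le> b" for x using that by simp
  have "\<bar>f x\<bar> \<le> max 1 D" for x
    using b[of x] D[of x] by (cases "norm x \<le> b") auto
  then show ?thesis by (rule that)
qed

lemma ball_ext_bounded:
  assumes "\<And>x. \<bar>f x\<bar> \<le> C"
  shows "\<bar>ball_ext f y\<bar> \<le> C"
  using assms[of "unsquash y"] by (auto simp: ball_ext_def intro: order_trans[OF abs_ge_zero])

text \<open>Open boxes are stable under intersection and generate the Borel sets. The indicator of a
  box is the limit of truncated multiples of the distance to its complement, and these have bounded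
  support.\<close>

lemma finite_measure_eqI_C0:
  fixes \<mu> \<nu> :: "(real ^ 'd) measure"
  assumes fin: "finite_measure \<mu>" "finite_measure \<nu>" and s: "sets \<mu> = sets borel" "sets \<nu> = sets borel"
    and eq: "\<And>f. f \<in> C0_functions \<Longrightarrow> (\<integral>x. f x \<partial>\<mu>) = (\<integral>x. f x \<partial>\<nu>)"
  shows "\<mu> = \<nu>"
proof -
  have box_eq: "emeasure \<mu> (box a b) = emeasure \<nu> (box a b)" for a b :: "real ^ 'd"
  proof -
    define U where "U = box a b"
    \<comment> \<open>\<open>infdist\<close> to the empty set is 0 by convention, so an empty
      complement would make every \<open>f n\<close> vanish identically.\<close>
    have "box a b \<noteq> UNIV" using not_bounded_UNIV bounded_box[of a b] by metis
    then have "- box a b \<noteq> {}" by (metis Compl_empty_eq double_complement)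
    then have U: "open U" "bounded U" "- U \<noteq> {}" unfolding U_def by auto
    define f where "f n x = min 1 (real n * infdist x (- U))" for n x
    have f01: "0 \<le> f n x" "f n x \<le> 1" for n x by (auto simp: f_def infdist_nonneg)
    have fc: "continuous_on UNIV (f n)" for n unfolding f_def by (intro continuous_intros)
    have f_out: "f n x = 0" if "x \<notin> U" for n x using that by (simp add: f_def)
    have C0: "f n \<in> C0_functions" for n
    proof -
      obtain B where B: "\<And>x. x \<in> U \<Longrightarrow> norm x \<le> B" using U(2) by (auto simp: bounded_iff)
      have "\<forall>\<^sub>F x in at_infinity. f n x = 0"
        unfolding eventually_at_infinity
        by (rule exI[of _ "B + 1"]) (use B f_out in fastforce)
      then have "(f n \<longlongrightarrow> 0) at_infinity" by (rule tendsto_eventually)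
      with fc show ?thesis by (simp add: C0_functions_def)
    qed
    have lim: "(\<lambda>n. f n x) \<longlonglongrightarrow> indicator U x" for x
    proof (cases "x \<in> U")
      case True
      then have "infdist x (- U) > 0"
        using U in_closed_iff_infdist_zero[of "- U" x] infdist_nonneg[of x "- U"] by force
      then obtain m :: nat where m: "1 < real m * infdist x (- U)" using reals_Archimedean3 by blast
      have "f n x = 1" if "n \<ge> m" for n
      proof -
        have "real m * infdist x (- U) \<le> real n * infdist x (- U)"
          using that by (intro mult_right_mono infdist_nonneg) auto
        then show ?thesis using m by (simp add: f_def)
      qed
      then have "\<forall>\<^sub>F n in sequentially. f n x = 1" by (auto simp: eventually_sequentially)
      then show ?thesis using True by (simp add: tendsto_eventually)
    qed (simp add: f_out)
    have conv: "(\<lambda>n. \<integral>x. f n x \<partial>L) \<longlonglongrightarrow> measure L U"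
      if "finite_measure L" "sets L = sets borel" for L
    proof -
      interpret finite_measure L by fact
      have fm: "f n \<in> borel_measurable L" for n
        unfolding measurable_cong_sets[OF that(2) refl] by (rule borel_measurable_continuous_onI[OF fc])
      have Um: "U \<in> sets L" using U that by simp
      have "(\<lambda>n. \<integral>x. f n x \<partial>L) \<longlonglongrightarrow> (\<integral>x. indicator U x \<partial>L)"
        using lim f01 Um fm by (intro integral_dominated_convergence[where w="\<lambda>_. 1"]) auto
      then show ?thesis using Um by (simp add: sets.Int_space_eq2)
    qed
    have "measure \<mu> U = measure \<nu> U"
      using conv[OF fin(1) s(1)] conv[OF fin(2) s(2)] eq[OF C0] LIMSEQ_unique by simp
    then show ?thesis
      using finite_measure.emeasure_eq_measure[OF fin(1)] finite_measure.emeasure_eq_measure[OF fin(2)]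
      by (simp add: U_def)
  qed
  show ?thesis
  proof (rule measure_eqI_generator_eq[where E="range (\<lambda>(a, b). box a b)" and \<Omega>=UNIV
        and A="\<lambda>n. box (- (real n *\<^sub>R One)) (real n *\<^sub>R One)"])
    show "Int_stable (range (\<lambda>(a, b). box a b :: (real ^ 'd) set))"
      by (auto simp: Int_stable_def Int_interval box_Int_box)
    have "sets (borel :: (real ^ 'd) measure) = sigma_sets UNIV (range (\<lambda>(a, b). box a b))"
      by (simp add: borel_eq_box)
    then show "sets \<mu> = sigma_sets UNIV (range (\<lambda>(a, b). box a b))"
      "sets \<nu> = sigma_sets UNIV (range (\<lambda>(a, b). box a b))" using s by auto
    show "(\<Union>n. box (- (real n *\<^sub>R One)) (real n *\<^sub>R One)) = (UNIV :: (real ^ 'd) set)"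
      by (rule UN_box_eq_UNIV)
    show "emeasure \<mu> (box (- (real n *\<^sub>R One)) (real n *\<^sub>R One)) \<noteq> \<infinity>" for n
      using finite_measure.emeasure_finite[OF fin(1)] by simp
  qed (use box_eq in auto)
qed

text \<open>\<open>ball_ext f\<close> vanishes on and beyond the unit sphere. The integral
  identities therefore concern only the image under \<open>unsquash\<close> of the part of
  \<open>R\<close> where \<open>Y\<close> is inside the open ball, and they determine this
  image.\<close>

lemma marginal_eqI:
  fixes Y :: "'a \<Rightarrow> real ^ 'd" and \<rho> :: "(real ^ 'd) measure"
  assumes R: "finite_measure R" and Y[measurable]: "Y \<in> borel_measurable R"
    and \<rho>: "sets \<rho> = sets borel" "finite_measure \<rho>"
    and eq: "\<And>f. f \<in> C0_functions \<Longrightarrow> (\<integral>t. ball_ext f (Y t) \<partial>R) = (\<integral>x. f x \<partial>\<rho>)"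
    and A: "A \<in> sets borel"
  shows "emeasure R {t \<in> space R. norm (Y t) < 1 \<and> unsquash (Y t) \<in> A} = emeasure \<rho> A"
proof -
  interpret R: finite_measure R by (rule R)
  define V where "V = {t \<in> space R. norm (Y t) < 1}"
  have V[measurable]: "V \<in> sets R" unfolding V_def by measurable
  define L where "L = density R (\<lambda>t. ennreal (indicator V t))"
  define \<mu> where "\<mu> = distr L borel (\<lambda>t. unsquash (Y t))"
  have Lm: "(\<lambda>t. unsquash (Y t)) \<in> borel_measurable L" unfolding L_def by measurable
  have em: "emeasure \<mu> B = emeasure R {t \<in> space R. norm (Y t) < 1 \<and> unsquash (Y t) \<in> B}"
    if [measurable]: "B \<in> sets borel" for B
  proof -
    have "emeasure \<mu> B = emeasure L ((\<lambda>t. unsquash (Y t)) -` B \<inter> space L)"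
      unfolding \<mu>_def by (rule emeasure_distr[OF Lm that])
    also have "\<dots> = (\<integral>\<^sup>+t. ennreal (indicator V t) * indicator ((\<lambda>t. unsquash (Y t)) -` B \<inter> space R) t \<partial>R)"
      unfolding L_def by (subst emeasure_density) auto
    also have "\<dots> = (\<integral>\<^sup>+t. indicator {t \<in> space R. norm (Y t) < 1 \<and> unsquash (Y t) \<in> B} t \<partial>R)"
      by (intro nn_integral_cong) (auto simp: V_def indicator_def)
    also have "\<dots> = emeasure R {t \<in> space R. norm (Y t) < 1 \<and> unsquash (Y t) \<in> B}"
      by (rule nn_integral_indicator) measurable
    finally show ?thesis .
  qed
  have "\<mu> = \<rho>"
  proof (rule finite_measure_eqI_C0)
    show "finite_measure \<mu>"
      by (rule finite_measureI) (simp add: em \<mu>_def[THEN arg_cong, of space] R.emeasure_finite)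
    fix f :: "real ^ 'd \<Rightarrow> real" assume f: "f \<in> C0_functions"
    then have fm[measurable]: "f \<in> borel_measurable borel"
      by (auto simp: C0_functions_def intro: borel_measurable_continuous_onI)
    have "(\<integral>x. f x \<partial>\<mu>) = (\<integral>t. f (unsquash (Y t)) \<partial>L)"
      unfolding \<mu>_def by (rule integral_distr[OF Lm fm])
    also have "\<dots> = (\<integral>t. indicator V t *\<^sub>R f (unsquash (Y t)) \<partial>R)"
      unfolding L_def by (rule integral_density) auto
    also have "\<dots> = (\<integral>t. ball_ext f (Y t) \<partial>R)"
      by (intro Bochner_Integration.integral_cong) (auto simp: V_def ball_ext_def)
    finally show "(\<integral>x. f x \<partial>\<mu>) = (\<integral>x. f x \<partial>\<rho>)" using eq[OF f] by simp
  qed (use \<rho> in \<open>auto simp: \<mu>_def\<close>)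
  with em[OF A] show ?thesis by simp
qed

section \<open>The Coulomb kernel on the compactified space\<close>

definition gap :: "real ^ 'd \<Rightarrow> real" where
  "gap y = max 0 (1 - norm y)"

definition kern_approx :: "nat \<Rightarrow> real ^ 'd \<Rightarrow> real ^ 'd \<Rightarrow> real" where
  "kern_approx m y y' = gap y * gap y' / max (norm (gap y' *\<^sub>R y - gap y *\<^sub>R y')) (1 / real (Suc m))"

text \<open>With \<open>s = gap y\<close> one has \<open>unsquash y = y / s\<close>, hence
  \<open>1 / norm (unsquash y - unsquash y') = s s' / norm (s' y - s y')\<close>; the truncated denominators make
  \<open>kern\<close> an increasing limit of continuous functions, including at the boundary of the ball.\<close>

definition kern :: "real ^ 'd \<Rightarrow> real ^ 'd \<Rightarrow> ennreal" where
  "kern y y' = (SUP m. ennreal (kern_approx m y y'))"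

lemma gap_bounds: "0 \<le> gap y" "gap y \<le> 1" by (auto simp: gap_def)

lemma kern_approx_nonneg: "0 \<le> kern_approx m y y'"
  by (auto simp: kern_approx_def gap_bounds le_max_iff_disj intro!: divide_nonneg_nonneg mult_nonneg_nonneg)

lemma kern_approx_le: "kern_approx m y y' \<le> real (Suc m)"
proof -
  have "kern_approx m y y' \<le> 1 / (1 / real (Suc m))"
    unfolding kern_approx_def using gap_bounds[of y] gap_bounds[of y']
    by (intro frac_le mult_le_one) (auto simp: le_max_iff_disj)
  then show ?thesis by simp
qed

lemma kern_approx_mono: "m \<le> n \<Longrightarrow> kern_approx m y y' \<le> kern_approx n y y'"
  unfolding kern_approx_def using gap_bounds[of y] gap_bounds[of y']
  by (intro divide_left_mono max.mono mult_nonneg_nonneg mult_pos_pos) (auto simp: frac_le less_max_iff_disj)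

lemma kern_approx_continuous:
  assumes "continuous_on UNIV f" "continuous_on UNIV g"
  shows "continuous_on UNIV (\<lambda>t. kern_approx m (f t) (g t))"
proof -
  have "max a (1 / real (Suc m)) \<noteq> 0" for a by (auto simp: max_def)
  then show ?thesis unfolding kern_approx_def gap_def
    by (intro continuous_intros assms) auto
qed

text \<open>A zero gap kills the numerator while the truncated denominator stays positive. So even
  two particles at the same boundary point have interaction 0, where the untruncated quotient would
  be 0/0.\<close>

lemma kern_outside:
  assumes "\<not> (norm y < 1 \<and> norm y' < 1)"
  shows "kern y y' = 0"
proof -
  have "kern_approx m y y' = 0" for m using assms by (auto simp: kern_approx_def gap_def)
  then show ?thesis by (simp add: kern_def)
qed

lemma kern_inside:
  assumes "norm y < 1" "norm y' < 1"
  shows "kern y y' = 1 / ennreal (norm (unsquash y - unsquash y'))"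
proof -
  define s where "s = 1 - norm y"
  define s' where "s' = 1 - norm y'"
  have pos: "s > 0" "s' > 0" using assms by (auto simp: s_def s'_def)
  have g: "gap y = s" "gap y' = s'" using assms by (auto simp: gap_def s_def s'_def)
  define D where "D = norm (s' *\<^sub>R y - s *\<^sub>R y')"
  have "inverse (s * s') * s' = inverse s" "inverse (s * s') * s = inverse s'"
    using pos by (simp_all add: field_simps)
  then have "unsquash y - unsquash y' = inverse (s * s') *\<^sub>R (s' *\<^sub>R y - s *\<^sub>R y')"
    by (simp only: unsquash_def s_def[symmetric] s'_def[symmetric] scaleR_diff_right scaleR_scaleR)
  then have n: "norm (unsquash y - unsquash y') = D / (s * s')"
    using pos by (simp add: D_def divide_inverse mult.commute)
  have ka: "kern_approx m y y' = s * s' / max D (1 / real (Suc m))" for m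
    by (simp add: kern_approx_def g D_def)
  \<comment> \<open>\<open>D = 0\<close> means that the particles coincide, and both sides are
    infinite. For \<open>D > 0\<close> the truncation is inactive as soon as
    \<open>1 / real (Suc m) < D\<close>, so the supremum is attained.\<close>
  show ?thesis
  proof (cases "D = 0")
    case True
    have ka0: "kern_approx m y y' = s * s' * real (Suc m)" for m
      by (simp add: ka True max_def)
    have "kern y y' = top" unfolding kern_def
    proof (rule ennreal_SUP_eq_top)
      fix n :: nat
      obtain m :: nat where "real n < real m * (s * s')" using reals_Archimedean3[of "s * s'"] pos by auto
      also have "\<dots> \<le> s * s' * real (Suc m)" using pos by (simp add: algebra_simps)
      finally have "ennreal (real n) \<le> ennreal (kern_approx m y y')"
        unfolding ka0 by (intro ennreal_leI) simp
      then show "\<exists>i\<in>UNIV. of_nat n \<le> ennreal (kern_approx i y y')"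
        by (auto simp: ennreal_of_nat_eq_real_of_nat)
    qed
    then show ?thesis using True n by (simp add: divide_ennreal_def)
  next
    case False
    then have D: "D > 0" by (simp add: D_def)
    obtain m where m: "inverse (real (Suc m)) < D" using reals_Archimedean[OF D] by blast
    have "kern y y' = ennreal (s * s' / D)"
      unfolding kern_def
    proof (rule antisym)
      show "(SUP m. ennreal (kern_approx m y y')) \<le> ennreal (s * s' / D)"
        using pos D unfolding ka
        by (intro SUP_least ennreal_leI divide_left_mono) (auto simp: less_max_iff_disj)
      have "kern_approx m y y' = s * s' / D" using m by (simp add: ka max_def inverse_eq_divide)
      then show "ennreal (s * s' / D) \<le> (SUP m. ennreal (kern_approx m y y'))"
        by (intro SUP_upper2[of m]) auto
    qed
    also have "\<dots> = 1 / ennreal (D / (s * s'))"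
      using D pos by (simp add: divide_ennreal[of 1, simplified])
    finally show ?thesis using n by simp
  qed
qed

definition energy :: "nat \<Rightarrow> (nat \<Rightarrow> 'a \<Rightarrow> real ^ 'd) \<Rightarrow> 'a measure \<Rightarrow> ennreal" where
  "energy N Y Q = (\<integral>\<^sup>+t. (\<Sum>(i, j) \<in> {(i, j). 1 \<le> i \<and> i < j \<and> j \<le> N}. kern (Y i t) (Y j t)) \<partial>Q)"

text \<open>Each truncated energy integrates a bounded continuous function and hence converges along
  the sequence; a supremum of such quantities is lower semicontinuous.\<close>

lemma energy_lsc:
  fixes Y :: "nat \<Rightarrow> real \<Rightarrow> real ^ 'd"
  assumes Y: "\<And>i. continuous_on UNIV (Y i)"
    and Q: "\<And>n. real_distribution (Q n)" and R: "real_distribution R"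
    and conv: "\<And>(f :: real \<Rightarrow> real) C. continuous_on UNIV f \<Longrightarrow> (\<And>t. \<bar>f t\<bar> \<le> C) \<Longrightarrow>
      (\<lambda>n. \<integral>t. f t \<partial>Q n) \<longlonglongrightarrow> (\<integral>t. f t \<partial>R)"
  shows "energy N Y R \<le> liminf (\<lambda>n. energy N Y (Q n))"
proof -
  let ?T = "{(i, j). 1 \<le> i \<and> i < j \<and> j \<le> N}"
  define g where "g m t = (\<Sum>(i, j) \<in> ?T. kern_approx m (Y i t) (Y j t))" for m t
  have gn: "0 \<le> g m t" for m t
    unfolding g_def by (intro sum_nonneg) (auto simp: kern_approx_nonneg)
  have ge: "ennreal (g m t) = (\<Sum>(i, j) \<in> ?T. ennreal (kern_approx m (Y i t) (Y j t)))" for m t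
    unfolding g_def by (subst sum_ennreal[symmetric]) (auto simp: kern_approx_nonneg case_prod_unfold)
  have gb: "\<bar>g m t\<bar> \<le> real (card ?T) * real (Suc m)" for m t
  proof -
    have "g m t \<le> real (card ?T) * real (Suc m)"
      unfolding g_def by (intro sum_bounded_above) (use kern_approx_le in auto)
    then show ?thesis using gn by simp
  qed
  have gc: "continuous_on UNIV (g m)" for m
    unfolding g_def by (intro continuous_on_sum) (auto intro!: kern_approx_continuous Y)
  have gm: "g m \<in> borel_measurable borel" for m
    by (rule borel_measurable_continuous_onI[OF gc])
  have ks: "(\<Sum>(i, j) \<in> ?T. kern (Y i t) (Y j t)) = (SUP m. ennreal (g m t))" for t
    unfolding ge kern_def case_prod_unfold
    by (subst ennreal_SUP_sum) (auto simp: incseq_def intro!: ennreal_leI kern_approx_mono)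
  have ei: "(\<integral>\<^sup>+t. ennreal (g m t) \<partial>L) = ennreal (\<integral>t. g m t \<partial>L)" if "real_distribution L" for m L
  proof -
    interpret real_distribution L by fact
    have "integrable L (g m)"
      using gm gb by (intro integrable_const_bound[where B="real (card ?T) * real (Suc m)"]) auto
    then show ?thesis using gn by (intro nn_integral_eq_integral) auto
  qed
  have inc: "incseq (\<lambda>m t. ennreal (g m t))"
    unfolding incseq_def le_fun_def g_def
    by (auto intro!: ennreal_leI sum_mono kern_approx_mono)
  have "energy N Y R = (SUP m. \<integral>\<^sup>+t. ennreal (g m t) \<partial>R)"
    unfolding energy_def ks
    using gm real_distribution.events_eq_borel[OF R] inc
    by (intro nn_integral_monotone_convergence_SUP) (auto cong: measurable_cong_sets)
  also have "\<dots> \<le> liminf (\<lambda>n. energy N Y (Q n))"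
  proof (rule SUP_least)
    fix m
    have "(\<lambda>n. ennreal (\<integral>t. g m t \<partial>Q n)) \<longlonglongrightarrow> ennreal (\<integral>t. g m t \<partial>R)"
      by (intro tendsto_ennrealI conv[OF gc gb])
    then have "liminf (\<lambda>n. \<integral>\<^sup>+t. ennreal (g m t) \<partial>Q n) = (\<integral>\<^sup>+t. ennreal (g m t) \<partial>R)"
      unfolding ei[OF Q] ei[OF R] by (intro lim_imp_Liminf) auto
    then have "(\<integral>\<^sup>+t. ennreal (g m t) \<partial>R) = liminf (\<lambda>n. \<integral>\<^sup>+t. ennreal (g m t) \<partial>Q n)" ..
    also have "\<dots> \<le> liminf (\<lambda>n. energy N Y (Q n))"
      unfolding energy_def ks
      by (intro Liminf_mono always_eventually allI nn_integral_mono SUP_upper) auto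
    finally show "(\<integral>\<^sup>+t. ennreal (g m t) \<partial>R) \<le> liminf (\<lambda>n. energy N Y (Q n))" .
  qed
  finally show ?thesis .
qed

text \<open>Both the marginals and the energy bounds may vary with \<open>n\<close>, so that one
  statement covers two limits: varying marginals under a constant bound, and fixed marginals under
  bounds that decrease to the minimal value.\<close>

lemma plan_compact:
  fixes \<rho> :: "(real ^ 'd) measure" and c :: "nat \<Rightarrow> ennreal"
  assumes Q: "\<And>n. real_distribution (Q n)" and supp: "\<And>n. emeasure (Q n) (- {0..1}) = 0"
    and conv: "\<And>i f. i \<in> {1..N} \<Longrightarrow> f \<in> C0_functions \<Longrightarrow>
      (\<lambda>n. \<integral>t. ball_ext f (curve i t) \<partial>Q n) \<longlonglongrightarrow> (\<integral>x. f x \<partial>\<rho>)"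
    and en: "\<And>n. energy N (curve :: nat \<Rightarrow> real \<Rightarrow> real ^ 'd) (Q n) \<le> c n" and c: "c \<longlonglongrightarrow> b"
  obtains R where "real_distribution R" "emeasure R (- {0..1}) = 0"
    "\<And>i f. i \<in> {1..N} \<Longrightarrow> f \<in> C0_functions \<Longrightarrow> (\<integral>t. ball_ext f (curve i t) \<partial>R) = (\<integral>x. f x \<partial>\<rho>)"
    "energy N (curve :: nat \<Rightarrow> real \<Rightarrow> real ^ 'd) R \<le> b"
proof -
  show ?thesis
  proof (rule unit_interval_compact[OF Q supp])
    fix r :: "nat \<Rightarrow> nat" and R
    assume r: "strict_mono r" and R: "real_distribution R" "emeasure R (- {0..1}) = 0"
      and lim: "\<And>(f :: real \<Rightarrow> real) C. continuous_on UNIV f \<Longrightarrow> (\<And>t. \<bar>f t\<bar> \<le> C) \<Longrightarrow>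
        (\<lambda>n. \<integral>t. f t \<partial>Q (r n)) \<longlonglongrightarrow> (\<integral>t. f t \<partial>R)"
    have "(\<integral>t. ball_ext f (curve i t) \<partial>R) = (\<integral>x. f x \<partial>\<rho>)"
      if i: "i \<in> {1..N}" and f: "f \<in> C0_functions" for i and f :: "real ^ 'd \<Rightarrow> real"
    proof -
      obtain C where "\<And>x. \<bar>f x\<bar> \<le> C" by (rule C0_bounded[OF f]) blast
      then have "\<bar>ball_ext f y\<bar> \<le> C" for y by (rule ball_ext_bounded)
      then have "(\<lambda>n. \<integral>t. ball_ext f (curve i t) \<partial>Q (r n)) \<longlonglongrightarrow> (\<integral>t. ball_ext f (curve i t) \<partial>R)"
        by (intro lim continuous_on_compose2[OF ball_ext_continuous[OF f] curve_continuous]) auto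
      moreover have "(\<lambda>n. \<integral>t. ball_ext f (curve i t) \<partial>Q (r n)) \<longlonglongrightarrow> (\<integral>x. f x \<partial>\<rho>)"
        using LIMSEQ_subseq_LIMSEQ[OF conv[OF i f] r] by (simp add: o_def)
      ultimately show ?thesis by (rule LIMSEQ_unique)
    qed
    moreover have "energy N (curve :: nat \<Rightarrow> real \<Rightarrow> real ^ 'd) R \<le> b"
    proof -
      have "energy N (curve :: nat \<Rightarrow> real \<Rightarrow> real ^ 'd) R \<le> liminf (\<lambda>n. energy N (curve :: nat \<Rightarrow> real \<Rightarrow> real ^ 'd) (Q (r n)))"
        by (rule energy_lsc[OF curve_continuous Q R(1) lim])
      also have "\<dots> \<le> liminf (\<lambda>n. c (r n))"
        by (intro Liminf_mono always_eventually allI en)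
      also have "\<dots> = b"
        using LIMSEQ_subseq_LIMSEQ[OF c r] by (intro lim_imp_Liminf) (auto simp: o_def)
      finally show ?thesis .
    qed
    ultimately show thesis using that R by blast
  qed
qed

section \<open>From limit plans to decompositions\<close>

lemma kern_commute: "kern y y' = kern y' y"
  unfolding kern_def kern_approx_def by (simp add: norm_minus_commute mult.commute)

lemma kern_measurable:
  assumes [measurable]: "f \<in> borel_measurable M" "g \<in> borel_measurable M"
  shows "(\<lambda>t. kern (f t) (g t)) \<in> borel_measurable M"
  unfolding kern_def kern_approx_def gap_def by measurable

lemma kern_sum_measurable:
  assumes "\<And>i. Y i \<in> borel_measurable M"
  shows "(\<lambda>t. \<Sum>(i, j) \<in> {(i, j). 1 \<le> i \<and> i < j \<and> j \<le> (N::nat)}. kern (Y i t) (Y j t)) \<in> borel_measurable M"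
  by (intro borel_measurable_sum) (auto intro: kern_measurable assms)

text \<open>An ordinary plan has all its particles in the open ball after squashing, where
  \<open>kern\<close> is the Coulomb kernel. So passing to the line preserves the cost
  exactly.\<close>

lemma lift_plan:
  fixes \<mu> :: "(real ^ 'd) measure"
  assumes P: "P \<in> couplings N \<mu>" "prob_space P"
  obtains Q where "real_distribution Q" "emeasure Q (- {0..1}) = 0"
    "\<And>i f. i \<in> {1..N} \<Longrightarrow> f \<in> C0_functions \<Longrightarrow> (\<integral>t. ball_ext f (curve i t) \<partial>Q) = (\<integral>x. f x \<partial>\<mu>)"
    "energy N (curve :: nat \<Rightarrow> real \<Rightarrow> real ^ 'd) Q = (\<integral>\<^sup>+x. coulomb N x \<partial>P)"
proof -
  interpret P: prob_space P by (rule P(2))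
  have sP: "sets P = sets (config_space N)" and marg: "\<And>i. i \<in> {1..N} \<Longrightarrow> distr P borel (\<lambda>x. x i) = \<mu>"
    using P(1) by (auto simp: couplings_def)
  have comp: "(\<lambda>x. x i) \<in> borel_measurable P" if "i \<in> {1..N}" for i
    unfolding measurable_cong_sets[OF sP refl] using that by (rule measurable_component_singleton)
  \<comment> \<open>\<open>curve_lift\<close> prescribes the particles of all indices at once; those
    outside \<open>{1..N}\<close> are parked at the centre of the ball.\<close>
  define Z where "Z i x = (if i \<in> {1..N} then squash (x i) else 0)" for i and x :: "nat \<Rightarrow> real ^ 'd"
  have Zm: "Z i \<in> borel_measurable P" for i
  proof (cases "i \<in> {1..N}")
    case True
    then have "Z i = (\<lambda>x. squash (x i))" by (simp add: Z_def fun_eq_iff)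
    then show ?thesis using measurable_compose[OF comp[OF True] squash_measurable] by simp
  next
    case False
    then have "Z i = (\<lambda>x. 0)" by (simp only: Z_def fun_eq_iff if_False simp_thms)
    then show ?thesis by simp
  qed
  have Zb: "norm (Z i x) < 1" for i x by (simp add: Z_def norm_squash_less)
  obtain \<tau> where \<tau>: "\<tau> \<in> borel_measurable P" "\<And>x. \<tau> x \<in> {0..1::real}" "\<And>i x. curve i (\<tau> x) = Z i x"
    by (rule curve_lift[where Z=Z and M=P, OF Zm Zb]) blast
  define Q where "Q = distr P borel \<tau>"
  have pm: "curve i \<in> borel_measurable borel" for i :: nat
    by (rule borel_measurable_continuous_onI[OF curve_continuous])
  show ?thesis
  proof (rule that)
    show "real_distribution Q"
      unfolding real_distribution_def real_distribution_axioms_def Q_def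
      using P.prob_space_distr[OF \<tau>(1)] by simp
    have "\<tau> -` (- {0..1}) \<inter> space P = {}" using \<tau>(2) by auto
    then show "emeasure Q (- {0..1}) = 0" by (simp add: Q_def emeasure_distr \<tau>(1))
    show "(\<integral>t. ball_ext f (curve i t) \<partial>Q) = (\<integral>x. f x \<partial>\<mu>)"
      if i: "i \<in> {1..N}" and f: "f \<in> C0_functions" for i f
    proof -
      have fm: "f \<in> borel_measurable borel"
        using f by (auto simp: C0_functions_def intro: borel_measurable_continuous_onI)
      have bm: "(\<lambda>t. ball_ext f (curve i t)) \<in> borel_measurable borel"
        by (intro measurable_compose[OF pm] borel_measurable_continuous_onI ball_ext_continuous f)
      have "(\<integral>t. ball_ext f (curve i t) \<partial>Q) = (\<integral>x. ball_ext f (curve i (\<tau> x)) \<partial>P)"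
        unfolding Q_def by (rule integral_distr[OF \<tau>(1) bm])
      also have "\<dots> = (\<integral>x. f (x i) \<partial>P)"
        using i by (simp add: \<tau>(3) Z_def ball_ext_squash)
      also have "\<dots> = (\<integral>x. f x \<partial>distr P borel (\<lambda>x. x i))"
        by (rule integral_distr[OF comp[OF i] fm, symmetric])
      finally show ?thesis by (simp add: marg[OF i])
    qed
    have "energy N (curve :: nat \<Rightarrow> real \<Rightarrow> real ^ 'd) Q = (\<integral>\<^sup>+x. (\<Sum>(i, j) \<in> {(i, j). 1 \<le> i \<and> i < j \<and> j \<le> N}.
        kern (curve i (\<tau> x)) (curve j (\<tau> x) :: real ^ 'd)) \<partial>P)"
      unfolding energy_def Q_def by (intro nn_integral_distr \<tau>(1) kern_sum_measurable) (simp add: pm)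
    also have "\<dots> = (\<integral>\<^sup>+x. coulomb N x \<partial>P)"
      unfolding coulomb_def
      by (intro nn_integral_cong sum.cong refl)
         (auto simp: \<tau>(3) Z_def kern_inside norm_squash_less unsquash_squash)
    finally show "energy N (curve :: nat \<Rightarrow> real \<Rightarrow> real ^ 'd) Q = (\<integral>\<^sup>+x. coulomb N x \<partial>P)" .
  qed
qed

text \<open>Pairs with a particle at infinity drop out. The numbering \<open>e\<close> of the others
  need not be monotone, so the comparison is made on ordered pairs.\<close>

lemma kern_sum_eq_coulomb:
  fixes y :: "nat \<Rightarrow> real ^ 'd"
  assumes e: "bij_betw e {1..k} {i \<in> {1..N}. norm (y i) < 1}"
  shows "(\<Sum>(i, j) \<in> {(i, j). 1 \<le> i \<and> i < j \<and> j \<le> N}. kern (y i) (y j)) = coulomb k (\<lambda>j. unsquash (y (e j)))"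
proof -
  define S where "S = {i \<in> {1..N}. norm (y i) < 1}"
  let ?V = "{(i, j). i \<in> {1..N} \<and> j \<in> {1..N} \<and> i \<noteq> j}" and ?W = "{(i, j). i \<in> S \<and> j \<in> S \<and> i \<noteq> j}"
  have "2 * (\<Sum>(i, j) \<in> {(i, j). 1 \<le> i \<and> i < j \<and> j \<le> N}. kern (y i) (y j)) = (\<Sum>(i, j) \<in> ?V. kern (y i) (y j))"
    by (rule sum_pairs_double) (rule kern_commute)
  also have "\<dots> = (\<Sum>(i, j) \<in> ?W. kern (y i) (y j))"
  proof (rule sum.mono_neutral_right)
    show "finite ?V" by (rule finite_subset[of _ "{1..N} \<times> {1..N}"]) auto
    show "\<forall>p \<in> ?V - ?W. (case p of (i, j) \<Rightarrow> kern (y i) (y j)) = 0"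
      by (auto simp: S_def intro!: kern_outside)
  qed (auto simp: S_def)
  also have "\<dots> = (\<Sum>(i, j) \<in> ?W. 1 / ennreal (norm (unsquash (y i) - unsquash (y j))))"
    by (intro sum.cong refl) (auto simp: S_def kern_inside)
  also have "\<dots> = 2 * coulomb k (\<lambda>j. unsquash (y (e j)))"
    unfolding coulomb_double
    by (rule sum_offdiagonal_reindex[symmetric,
          where h="\<lambda>i j. 1 / ennreal (norm (unsquash (y i) - unsquash (y j)))"])
       (use e in \<open>simp add: S_def\<close>)
  finally show ?thesis by (simp add: ennreal_mult_cancel_left)
qed

text \<open>The summation starts at 1. The case \<open>n = 0\<close> will be a configuration with no
  finite particle, for which \<open>h\<close> is an empty sum.\<close>

lemma sum_indicator_nat_eq:
  fixes h :: ennreal and n N :: nat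
  assumes "n \<le> N" "n = 0 \<Longrightarrow> h = 0"
  shows "(\<Sum>k=1..N. (if n = k then h else 0)) = h"
  using assms sum.delta'[of "{1..N}" n "\<lambda>_. h"] by (cases "n = 0") auto

text \<open>The factor 1/k from averaging the particles within a sector cancels the k in k/N. What
  remains is 1/N times the sum of the finite parts of the laws of all \<open>N\<close> particles,
  and each of these equals \<rho>.\<close>

lemma plan_to_decomposition:
  fixes Y :: "nat \<Rightarrow> 'a \<Rightarrow> real ^ 'd" and \<rho> :: "(real ^ 'd) measure"
  assumes R: "prob_space R" and Y[measurable]: "\<And>i. Y i \<in> borel_measurable R" and N: "1 \<le> N"
    and marg: "\<And>i A. i \<in> {1..N} \<Longrightarrow> A \<in> sets borel \<Longrightarrow>
      emeasure R {t \<in> space R. norm (Y i t) < 1 \<and> unsquash (Y i t) \<in> A} = emeasure \<rho> A"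
  shows "\<exists>\<rho>s \<in> decompositions N \<rho>. (\<Sum>k=1..N. partial_cost k (\<rho>s k)) \<le> energy N Y R"
proof -
  interpret R: prob_space R by (rule R)
  define S where "S t = {i \<in> {1..N}. norm (Y i t) < 1}" for t
  \<comment> \<open>Particles are numbered from 1, list positions from 0. For \<open>j\<close>
    beyond \<open>card T\<close> the value is arbitrary, but on the sector \<open>V k\<close> only
    indices up to \<open>k\<close> enter.\<close>
  define e where "e T j = sorted_list_of_set T ! (j - 1)" for T :: "nat set" and j :: nat
  define X where "X j t = unsquash (Y (e (S t) j) t)" for j t
  define V where "V k = {t \<in> space R. card (S t) = k}" for k
  \<comment> \<open>The restriction is not normalized: \<open>\<rho>s k\<close> gets the mass of the
    sector \<open>V k\<close>. The mass of \<open>V 0\<close>, where nothing is finite, is what the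
    sum of the masses may fall short of 1 by.\<close>
  define L where "L k = density R (indicator (V k))" for k
  have finS: "finite (S t)" for t by (simp add: S_def)
  have subS: "S t \<subseteq> {1..N}" for t by (auto simp: S_def)
  have cardS: "card (S t) \<le> N" for t
    using card_mono[OF _ subS[of t]] by simp
  have e_bij: "bij_betw (e T) {1..card T} T" if "finite T" for T
  proof -
    have "bij_betw ((!) (sorted_list_of_set T)) {..<card T} T"
      using that by (intro bij_betw_nth) auto
    moreover have "bij_betw (\<lambda>j. j - 1) {1..card T} {..<card T}"
      by (rule bij_betw_byWitness[where f'=Suc]) auto
    moreover have "e T = (!) (sorted_list_of_set T) \<circ> (\<lambda>j. j - 1)"
      by (simp add: fun_eq_iff e_def)
    ultimately show ?thesis by (simp only: bij_betw_trans)
  qed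
  have Sm: "S \<in> measurable R (count_space (Pow {1..N}))"
  proof (subst measurable_count_space_eq2)
    have "S -` {T} \<inter> space R \<in> sets R" if "T \<in> Pow {1..N}" for T
    proof -
      have "S t = T \<longleftrightarrow> (\<forall>i\<in>{1..N}. (i \<in> T) = (i \<in> S t))" for t
        using that subS[of t] by blast
      then have "S t = T \<longleftrightarrow> (\<forall>i\<in>{1..N}. (i \<in> T) = (norm (Y i t) < 1))" for t
        by (simp add: S_def)
      then have "S -` {T} \<inter> space R = {t \<in> space R. \<forall>i\<in>{1..N}. (i \<in> T) = (norm (Y i t) < 1)}"
        by blast
      also have "\<dots> \<in> sets R" by measurable
      finally show ?thesis .
    qed
    then show "S \<in> space R \<rightarrow> Pow {1..N} \<and> (\<forall>T\<in>Pow {1..N}. S -` {T} \<inter> space R \<in> sets R)"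
      by (auto simp: S_def)
  qed simp
  have Vm[measurable]: "V k \<in> sets R" for k
  proof -
    have "(\<lambda>t. card (S t)) \<in> measurable R (count_space UNIV)"
      by (rule measurable_compose[OF Sm]) simp
    then have "(\<lambda>t. card (S t)) -` {k} \<inter> space R \<in> sets R" by (rule measurable_sets) simp
    then show ?thesis by (simp add: V_def vimage_def Collect_conj_eq Int_commute)
  qed
  \<comment> \<open>For a fixed set \<open>T\<close> the index \<open>e T j\<close> is a constant,
    and \<open>S\<close> takes only finitely many values, so a case distinction over
    \<open>T\<close> gives measurability.\<close>
  have Xm[measurable]: "X j \<in> borel_measurable R" for j
    unfolding X_def
    by (rule measurable_compose_countable'[where f="\<lambda>T t. unsquash (Y (e T j) t)", OF _ Sm])
       (auto intro: measurable_compose[OF Y unsquash_measurable] countable_finite)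
  have Lint: "(\<integral>\<^sup>+t. g t \<partial>L k) = (\<integral>\<^sup>+t. indicator (V k) t * g t \<partial>R)" if "g \<in> borel_measurable R" for g k
    unfolding L_def using that by (intro nn_integral_density) auto
  have XL: "X j \<in> borel_measurable (L k)" for j k by (simp add: L_def)
  have Lem: "emeasure (L k) (X j -` A \<inter> space (L k)) = (\<integral>\<^sup>+t. indicator (V k) t * indicator A (X j t) \<partial>R)"
    if [measurable]: "A \<in> sets borel" for A j k
  proof -
    have "emeasure (L k) (X j -` A \<inter> space (L k)) = (\<integral>\<^sup>+t. indicator (X j -` A \<inter> space (L k)) t \<partial>L k)"
      by (rule nn_integral_indicator[symmetric]) (rule measurable_sets[OF XL that])
    also have "\<dots> = (\<integral>\<^sup>+t. indicator A (X j t) \<partial>L k)"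
      by (intro nn_integral_cong) (auto simp: indicator_def)
    finally show ?thesis by (simp add: Lint)
  qed
  have "\<exists>\<mu>. sets \<mu> = sets borel \<and>
      (\<forall>A\<in>sets borel. emeasure \<mu> A = (\<Sum>j=1..k. ennreal (1 / real k) * emeasure (L k) (X j -` A \<inter> space (L k)))) \<and>
      partial_cost k \<mu> \<le> (\<integral>\<^sup>+t. coulomb k (\<lambda>j. X j t) \<partial>L k)" if k: "k \<in> {1..N}" for k
  proof -
    have "1 \<le> k" using k by simp
    then show ?thesis
    proof (rule cyclic_symmetrization[where X=X and M="L k"])
      fix P \<mu> assume \<mu>: "sets \<mu> = sets borel" "P \<in> couplings k \<mu>"
        "\<And>A. A \<in> sets borel \<Longrightarrow> emeasure \<mu> A = (\<Sum>i=1..k. ennreal (1 / real k) * emeasure (L k) (X i -` A \<inter> space (L k)))"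
        "(\<integral>\<^sup>+x. coulomb k x \<partial>P) = (\<integral>\<^sup>+t. coulomb k (\<lambda>i. X i t) \<partial>L k)"
      have "partial_cost k \<mu> \<le> (\<integral>\<^sup>+x. coulomb k x \<partial>P)"
        using \<mu>(2) by (auto simp: partial_cost_def intro: INF_lower)
      then show ?thesis using \<mu> by (intro exI[of _ \<mu>]) simp
    qed (rule XL)
  qed
  then have "\<forall>k\<in>{1..N}. \<exists>\<mu>. sets \<mu> = sets borel \<and>
      (\<forall>A\<in>sets borel. emeasure \<mu> A = (\<Sum>j=1..k. ennreal (1 / real k) * emeasure (L k) (X j -` A \<inter> space (L k)))) \<and>
      partial_cost k \<mu> \<le> (\<integral>\<^sup>+t. coulomb k (\<lambda>j. X j t) \<partial>L k)" by blast
  from bchoice[OF this] obtain \<rho>s where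
    \<rho>s: "\<forall>k\<in>{1..N}. sets (\<rho>s k) = sets borel \<and>
      (\<forall>A\<in>sets borel. emeasure (\<rho>s k) A = (\<Sum>j=1..k. ennreal (1 / real k) * emeasure (L k) (X j -` A \<inter> space (L k)))) \<and>
      partial_cost k (\<rho>s k) \<le> (\<integral>\<^sup>+t. coulomb k (\<lambda>j. X j t) \<partial>L k)" by (elim exE)
  have em: "emeasure (\<rho>s k) A = (\<integral>\<^sup>+t. ennreal (1 / real k) * (\<Sum>j=1..k. indicator (V k) t * indicator A (X j t)) \<partial>R)"
    if "k \<in> {1..N}" and [measurable]: "A \<in> sets borel" for k A
  proof -
    have "emeasure (\<rho>s k) A = ennreal (1 / real k) * (\<Sum>j=1..k. \<integral>\<^sup>+t. indicator (V k) t * indicator A (X j t) \<partial>R)"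
      using that \<rho>s by (simp add: Lem sum_distrib_left)
    also have "\<dots> = ennreal (1 / real k) * (\<integral>\<^sup>+t. (\<Sum>j=1..k. indicator (V k) t * indicator A (X j t)) \<partial>R)"
      by (subst nn_integral_sum) auto
    finally show ?thesis by (subst nn_integral_cmult) auto
  qed
  \<comment> \<open>Among the sectors only \<open>k = card (S t)\<close> contributes at
    \<open>t\<close>, and there \<open>e (S t)\<close> runs once through the finite
    particles.\<close>
  have pt: "(\<Sum>k=1..N. \<Sum>j=1..k. indicator (V k) t * indicator A (X j t)) =
      (\<Sum>i=1..N. indicator {t \<in> space R. norm (Y i t) < 1 \<and> unsquash (Y i t) \<in> A} t :: ennreal)"
    if t: "t \<in> space R" for t A
  proof -
    define h :: "nat \<Rightarrow> ennreal" where "h i = indicator A (unsquash (Y i t))" for i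
    have "(\<Sum>j=1..k. indicator (V k) t * indicator A (X j t)) = (if card (S t) = k then (\<Sum>i\<in>S t. h i) else 0)" for k
    proof (cases "card (S t) = k")
      case True
      have "(\<Sum>j=1..k. indicator A (X j t)) = (\<Sum>i\<in>S t. h i)"
        using sum.reindex_bij_betw[OF e_bij[OF finS[of t]], of h] True by (simp add: X_def h_def)
      then show ?thesis using True t by (simp add: V_def)
    qed (use t in \<open>simp add: V_def\<close>)
    then have "(\<Sum>k=1..N. \<Sum>j=1..k. indicator (V k) t * indicator A (X j t)) =
        (\<Sum>k=1..N. (if card (S t) = k then (\<Sum>i\<in>S t. h i) else 0))" by (simp only:)
    also have "\<dots> = (\<Sum>i\<in>S t. h i)"
      by (intro sum_indicator_nat_eq cardS) (simp add: finS)
    also have "\<dots> = (\<Sum>i=1..N. if norm (Y i t) < 1 then h i else 0)"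
      unfolding S_def by (rule sum.inter_filter) simp
    also have "\<dots> = (\<Sum>i=1..N. indicator {t \<in> space R. norm (Y i t) < 1 \<and> unsquash (Y i t) \<in> A} t)"
      using t by (intro sum.cong) (auto simp: h_def indicator_def)
    finally show ?thesis .
  qed
  have dec_eq: "(\<Sum>k=1..N. ennreal (real k / real N) * emeasure (\<rho>s k) A) = emeasure \<rho> A"
    if [measurable]: "A \<in> sets borel" for A
  proof -
    have "ennreal (real k / real N) * emeasure (\<rho>s k) A =
        ennreal (1 / real N) * (\<integral>\<^sup>+t. (\<Sum>j=1..k. indicator (V k) t * indicator A (X j t)) \<partial>R)"
      if k: "k \<in> {1..N}" for k
    proof -
      have "ennreal (real k / real N) * ennreal (1 / real k) = ennreal (1 / real N)"
        using k by (simp flip: ennreal_mult')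
      then show ?thesis unfolding em[OF k \<open>A \<in> sets borel\<close>]
        by (subst nn_integral_cmult) (auto simp flip: mult.assoc)
    qed
    then have "(\<Sum>k=1..N. ennreal (real k / real N) * emeasure (\<rho>s k) A) =
        ennreal (1 / real N) * (\<Sum>k=1..N. \<integral>\<^sup>+t. (\<Sum>j=1..k. indicator (V k) t * indicator A (X j t)) \<partial>R)"
      by (simp add: sum_distrib_left)
    also have "(\<Sum>k=1..N. \<integral>\<^sup>+t. (\<Sum>j=1..k. indicator (V k) t * indicator A (X j t)) \<partial>R) =
        (\<integral>\<^sup>+t. (\<Sum>k=1..N. \<Sum>j=1..k. indicator (V k) t * indicator A (X j t)) \<partial>R)"
      by (rule nn_integral_sum[symmetric]) measurable
    also have "\<dots> = (\<integral>\<^sup>+t. (\<Sum>i=1..N. indicator {t \<in> space R. norm (Y i t) < 1 \<and> unsquash (Y i t) \<in> A} t) \<partial>R)"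
      by (intro nn_integral_cong pt)
    also have "\<dots> = (\<Sum>i=1..N. \<integral>\<^sup>+t. indicator {t \<in> space R. norm (Y i t) < 1 \<and> unsquash (Y i t) \<in> A} t \<partial>R)"
      by (rule nn_integral_sum) measurable
    also have "\<dots> = (\<Sum>i=1..N. emeasure \<rho> A)"
    proof (rule sum.cong[OF refl])
      fix i assume i: "i \<in> {1..N}"
      have "{t \<in> space R. norm (Y i t) < 1 \<and> unsquash (Y i t) \<in> A} \<in> sets R" by measurable
      then show "(\<integral>\<^sup>+t. indicator {t \<in> space R. norm (Y i t) < 1 \<and> unsquash (Y i t) \<in> A} t \<partial>R) = emeasure \<rho> A"
        using marg[OF i that] by simp
    qed
    also have "ennreal (1 / real N) * (\<Sum>i=1..N. emeasure \<rho> A) = (ennreal (1 / real N) * ennreal (real N)) * emeasure \<rho> A"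
      by (simp add: mult.assoc ennreal_of_nat_eq_real_of_nat)
    also have "\<dots> = emeasure \<rho> A"
      using N by (simp flip: ennreal_mult')
    finally show ?thesis .
  qed
  have mass: "emeasure (\<rho>s k) UNIV = emeasure R (V k)" if k: "k \<in> {1..N}" for k
  proof -
    have "ennreal (1 / real k) * of_nat k = 1"
      using k by (simp add: ennreal_of_nat_eq_real_of_nat flip: ennreal_mult')
    moreover have "UNIV \<in> sets (borel :: (real ^ 'd) measure)" by simp
    ultimately have "emeasure (\<rho>s k) UNIV = (\<integral>\<^sup>+t. indicator (V k) t \<partial>R)"
      by (subst em[OF k]) (auto intro!: nn_integral_cong simp flip: mult.assoc)
    then show ?thesis by simp
  qed
  have one: "(\<Sum>k=1..N. indicator (V k) t :: ennreal) \<le> 1" for t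
  proof -
    have "(\<Sum>k=1..N. indicator (V k) t :: ennreal) \<le> (\<Sum>k=1..N. if card (S t) = k then 1 else 0)"
      by (intro sum_mono) (auto simp: V_def indicator_def)
    also have "\<dots> \<le> 1" by (simp add: sum.delta')
    finally show ?thesis .
  qed
  have tot: "(\<Sum>k=1..N. emeasure (\<rho>s k) UNIV) \<le> 1"
  proof -
    have "(\<Sum>k=1..N. emeasure (\<rho>s k) UNIV) = (\<Sum>k=1..N. \<integral>\<^sup>+t. indicator (V k) t \<partial>R)"
      by (intro sum.cong refl) (simp add: mass)
    also have "\<dots> = (\<integral>\<^sup>+t. (\<Sum>k=1..N. indicator (V k) t) \<partial>R)"
      by (rule nn_integral_sum[symmetric]) measurable
    also have "\<dots> \<le> (\<integral>\<^sup>+t. 1 \<partial>R)" by (intro nn_integral_mono one)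
    also have "\<dots> = 1" by (simp add: R.emeasure_space_1)
    finally show ?thesis .
  qed
  have "\<rho>s \<in> decompositions N \<rho>"
    unfolding decompositions_def Subprobs_def using \<rho>s dec_eq tot mass R.emeasure_le_1 by auto
  moreover have "(\<Sum>k=1..N. partial_cost k (\<rho>s k)) \<le> energy N Y R"
  proof -
    define E where "E t = (\<Sum>(i, j) \<in> {(i, j). 1 \<le> i \<and> i < j \<and> j \<le> N}. kern (Y i t) (Y j t))" for t
    have Em[measurable]: "E \<in> borel_measurable R" unfolding E_def by (rule kern_sum_measurable) measurable
    have "partial_cost k (\<rho>s k) \<le> (\<integral>\<^sup>+t. indicator (V k) t * E t \<partial>R)" if k: "k \<in> {1..N}" for k
    proof -
      have "partial_cost k (\<rho>s k) \<le> (\<integral>\<^sup>+t. coulomb k (\<lambda>j. X j t) \<partial>L k)" using \<rho>s k by blast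
      also have "\<dots> = (\<integral>\<^sup>+t. indicator (V k) t * coulomb k (\<lambda>j. X j t) \<partial>R)"
        by (intro Lint coulomb_measurable Xm)
      also have "\<dots> = (\<integral>\<^sup>+t. indicator (V k) t * E t \<partial>R)"
      proof (intro nn_integral_cong)
        fix t
        show "indicator (V k) t * coulomb k (\<lambda>j. X j t) = indicator (V k) t * E t"
        proof (cases "t \<in> V k")
          case True
          then have "bij_betw (e (S t)) {1..k} {i \<in> {1..N}. norm (Y i t) < 1}"
            using e_bij[OF finS[of t]] by (simp add: V_def S_def)
          from kern_sum_eq_coulomb[OF this] show ?thesis by (simp add: E_def X_def)
        qed simp
      qed
      finally show ?thesis .
    qed
    then have "(\<Sum>k=1..N. partial_cost k (\<rho>s k)) \<le> (\<Sum>k=1..N. \<integral>\<^sup>+t. indicator (V k) t * E t \<partial>R)"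
      by (rule sum_mono)
    also have "\<dots> = (\<integral>\<^sup>+t. (\<Sum>k=1..N. indicator (V k) t) * E t \<partial>R)"
      by (subst nn_integral_sum[symmetric]) (auto simp: sum_distrib_right)
    also have "\<dots> \<le> (\<integral>\<^sup>+t. 1 * E t \<partial>R)" by (intro nn_integral_mono mult_right_mono one) simp
    finally show ?thesis by (simp add: energy_def E_def)
  qed
  ultimately show ?thesis by blast
qed

text \<open>Two successive limits replace a diagonal extraction: for each \<open>c\<close> above the
  relaxed cost there is a limit plan whose finite marginals are already \<rho> itself, and the
  condition \<open>good\<close> survives the second limit, in which \<open>c\<close> decreases to
  the relaxed cost.\<close>

lemma relaxed_cost_attained:
  fixes \<rho> :: "(real ^ 'd) measure"
  assumes N: "1 \<le> N" and \<rho>: "\<rho> \<in> Subprobs" and fin: "relaxed_cost N \<rho> < \<infinity>"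
  shows "\<exists>\<rho>s \<in> decompositions N \<rho>. (\<Sum>k=1..N. partial_cost k (\<rho>s k)) \<le> relaxed_cost N \<rho>"
proof -
  define good where "good R c \<longleftrightarrow> real_distribution R \<and> emeasure R (- {0..1}) = 0 \<and>
    (\<forall>i\<in>{1..N}. \<forall>f\<in>C0_functions. (\<integral>t. ball_ext f (curve i t) \<partial>R) = (\<integral>x. f x \<partial>\<rho>)) \<and>
    energy N (curve :: nat \<Rightarrow> real \<Rightarrow> real ^ 'd) R \<le> c" for R and c
  have approx: "\<exists>R. good R c" if c: "relaxed_cost N \<rho> < c" for c
  proof -
    obtain \<rho>s where \<rho>s: "\<And>n. \<rho>s n \<in> Probs" "weak_star_conv \<rho>s \<rho>" "liminf (\<lambda>n. mm_cost N (\<rho>s n)) < c"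
      using c unfolding relaxed_cost_def by (auto simp: INF_less_iff)
    have "infinite {n. mm_cost N (\<rho>s n) < c}"
    proof
      assume "finite {n. mm_cost N (\<rho>s n) < c}"
      then have "\<forall>\<^sub>F n in sequentially. \<not> mm_cost N (\<rho>s n) < c"
        unfolding cofinite_eq_sequentially[symmetric] eventually_cofinite by simp
      then have "c \<le> liminf (\<lambda>n. mm_cost N (\<rho>s n))"
        by (intro Liminf_bounded) (simp add: not_less)
      with \<rho>s(3) show False by simp
    qed
    then obtain r where r: "strict_mono (r :: nat \<Rightarrow> nat)" "\<And>n. mm_cost N (\<rho>s (r n)) < c"
      using infinite_enumerate by blast
    have "\<exists>Q. real_distribution Q \<and> emeasure Q (- {0..1}) = 0 \<and>
      (\<forall>i\<in>{1..N}. \<forall>f\<in>C0_functions. (\<integral>t. ball_ext f (curve i t) \<partial>Q) = (\<integral>x. f x \<partial>\<rho>s (r n))) \<and>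
      energy N (curve :: nat \<Rightarrow> real \<Rightarrow> real ^ 'd) Q \<le> c" for n
    proof -
      obtain P where P: "P \<in> couplings N (\<rho>s (r n))" "prob_space P" "(\<integral>\<^sup>+x. coulomb N x \<partial>P) < c"
        using r(2)[of n] unfolding mm_cost_def by (auto simp: INF_less_iff)
      show ?thesis
      proof (rule lift_plan[OF P(1,2)])
        fix Q assume "real_distribution Q" "emeasure Q (- {0..1}) = 0"
        "\<And>i f. i \<in> {1..N} \<Longrightarrow> f \<in> C0_functions \<Longrightarrow> (\<integral>t. ball_ext f (curve i t) \<partial>Q) = (\<integral>x. f x \<partial>\<rho>s (r n))"
        "energy N (curve :: nat \<Rightarrow> real \<Rightarrow> real ^ 'd) Q = (\<integral>\<^sup>+x. coulomb N x \<partial>P)"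
        then show ?thesis using P(3) by (intro exI[of _ Q]) auto
      qed
    qed
    then obtain Q where Q: "\<And>n. real_distribution (Q n)" "\<And>n. emeasure (Q n) (- {0..1}) = 0"
      "\<And>n i f. i \<in> {1..N} \<Longrightarrow> f \<in> C0_functions \<Longrightarrow> (\<integral>t. ball_ext f (curve i t) \<partial>Q n) = (\<integral>x. f x \<partial>\<rho>s (r n))"
      "\<And>n. energy N (curve :: nat \<Rightarrow> real \<Rightarrow> real ^ 'd) (Q n) \<le> c" by metis
    have "(\<lambda>n. \<integral>t. ball_ext f (curve i t) \<partial>Q n) \<longlonglongrightarrow> (\<integral>x. f x \<partial>\<rho>)"
      if "i \<in> {1..N}" "f \<in> C0_functions" for i f
      using LIMSEQ_subseq_LIMSEQ[OF _ r(1), of "\<lambda>n. \<integral>x. f x \<partial>\<rho>s n"] \<rho>s(2) that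
      by (simp add: Q(3) weak_star_conv_def o_def)
    from plan_compact[OF Q(1,2) this Q(4) tendsto_const] show ?thesis
      unfolding good_def by metis
  qed
  obtain v where v: "relaxed_cost N \<rho> = ennreal v" "0 \<le> v"
    using fin by (cases "relaxed_cost N \<rho>") auto
  have "\<exists>R. good R (ennreal (v + 1 / real (Suc n)))" for n
    using v by (intro approx) (auto intro!: ennreal_lessI)
  then obtain Q where Q: "\<And>n. good (Q n) (ennreal (v + 1 / real (Suc n)))" by metis
  have "(\<lambda>n. v + 1 / real (Suc n)) \<longlonglongrightarrow> v + 0"
    by (intro tendsto_add tendsto_const LIMSEQ_Suc lim_1_over_n)
  then have lim: "(\<lambda>n. ennreal (v + 1 / real (Suc n))) \<longlonglongrightarrow> ennreal v"
    by (intro tendsto_ennrealI) simp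
  obtain R where R: "real_distribution R"
    "\<And>i f. i \<in> {1..N} \<Longrightarrow> f \<in> C0_functions \<Longrightarrow> (\<integral>t. ball_ext f (curve i t) \<partial>R) = (\<integral>x. f x \<partial>\<rho>)"
    "energy N (curve :: nat \<Rightarrow> real \<Rightarrow> real ^ 'd) R \<le> ennreal v"
  proof (rule plan_compact[where Q=Q and N=N and \<rho>=\<rho>, OF _ _ _ _ lim])
    show "(\<lambda>n. \<integral>t. ball_ext f (curve i t) \<partial>Q n) \<longlonglongrightarrow> (\<integral>x. f x \<partial>\<rho>)"
      if "i \<in> {1..N}" "f \<in> C0_functions" for i f
      using Q that by (simp add: good_def)
  qed (use Q in \<open>auto simp: good_def\<close>)
  interpret R: real_distribution R by (rule R(1))
  have pm: "(curve i :: real \<Rightarrow> real ^ 'd) \<in> borel_measurable R" for i :: nat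
    using borel_measurable_continuous_onI[OF curve_continuous] by (simp cong: measurable_cong_sets)
  have "finite_measure \<rho>" "sets \<rho> = sets borel"
    using \<rho> sets_eq_imp_space_eq[of \<rho> borel]
    by (auto simp: Subprobs_def top_unique intro!: finite_measureI)
  then have "\<exists>\<rho>s \<in> decompositions N \<rho>. (\<Sum>k=1..N. partial_cost k (\<rho>s k)) \<le> energy N (curve :: nat \<Rightarrow> real \<Rightarrow> real ^ 'd) R"
    using R(2) R.finite_measure_axioms
    by (intro plan_to_decomposition[OF R.prob_space_axioms pm N] marginal_eqI pm)
  then show ?thesis using R(3) v by (auto intro: order_trans)
qed

section \<open>Recovery sequences\<close>

text \<open>In the weak* limit only the positions \<open>i \<le> k\<close> of the sector
  \<open>k\<close> remain visible, that is \<open>k\<close> positions out of \<open>N\<close>; this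
  produces the weights k/N. The couplings need not be optimal, so almost optimal ones can be
  inserted.\<close>

lemma upper_bound_of_couplings:
  fixes \<rho> :: "(real ^ 'd) measure"
  assumes N: "1 \<le> N" and dec: "\<rho>s \<in> decompositions N \<rho>" and \<rho>: "\<rho> \<in> Subprobs"
    and P: "\<And>k. k \<in> {1..N} \<Longrightarrow> P k \<in> couplings k (\<rho>s k)"
  shows "relaxed_cost N \<rho> \<le> (\<Sum>k=1..N. \<integral>\<^sup>+x. coulomb k x \<partial>P k)"
proof -
  have \<rho>s: "sets (\<rho>s k) = sets borel" "emeasure (\<rho>s k) UNIV \<le> 1" if "k \<in> {1..N}" for k
    using dec that by (auto simp: decompositions_def Subprobs_def)
  have id: "\<And>A. A \<in> sets borel \<Longrightarrow> (\<Sum>k=1..N. ennreal (real k / real N) * emeasure (\<rho>s k) A) = emeasure \<rho> A"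
    and tot: "(\<Sum>k=1..N. emeasure (\<rho>s k) UNIV) \<le> 1"
    using dec unfolding decompositions_def by blast+
  have fin\<rho>: "finite_measure (\<rho>s k)" if "k \<in> {1..N}" for k
    using \<rho>s[OF that] sets_eq_imp_space_eq[OF \<rho>s(1)[OF that]]
    by (auto simp: top_unique intro!: finite_measureI)
  obtain u :: "real ^ 'd" where u: "norm u = 1" using vector_choose_size[of 1] by auto
  \<comment> \<open>The missing mass \<open>m0\<close> is carried by the configuration without finite particles.\<close>
  define m0 where "m0 = 1 - (\<Sum>k=1..N. measure (\<rho>s k) UNIV)"
  have tot_meas: "(\<Sum>k=1..N. emeasure (\<rho>s k) UNIV) = ennreal (\<Sum>k=1..N. measure (\<rho>s k) UNIV)"
  proof -
    have "(\<Sum>k=1..N. emeasure (\<rho>s k) UNIV) = (\<Sum>k=1..N. ennreal (measure (\<rho>s k) UNIV))"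
      by (intro sum.cong refl finite_measure.emeasure_eq_measure fin\<rho>)
    then show ?thesis by (simp add: sum_ennreal)
  qed
  have m0: "0 \<le> m0"
    using tot unfolding tot_meas m0_def by (simp add: ennreal_le_1)
  \<comment> \<open>\<open>P k\<close> already has the mass of \<open>\<rho>s k\<close>, so its
    weight is 1 for \<open>k \<ge> 1\<close>. For \<open>k = 0\<close> the plan is the Dirac measure
    at the only point of the empty product, weighted by the missing mass.\<close>
  define w where "w k = (if k = 0 then m0 else 1)" for k :: nat
  define L where "L k = (if k = 0 then return (config_space 0) (\<lambda>_. undefined) else P k)" for k :: nat
  have w0: "0 \<le> w k" for k using m0 by (simp add: w_def)
  have sL: "sets (L k) = sets (config_space k)" if "k \<in> {0..N}" for k
    using P[of k] that by (auto simp: L_def couplings_def)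
  have comp: "(\<lambda>x. x i) \<in> borel_measurable (L k)" if "k \<in> {0..N}" "i \<in> {1..k}" for i k
    unfolding measurable_cong_sets[OF sL[OF that(1)] refl] using that(2) by (rule measurable_component_singleton)
  have marg: "distr (L k) borel (\<lambda>x. x i) = \<rho>s k" if "k \<in> {1..N}" "i \<in> {1..k}" for i k
    using P[OF that(1)] that by (auto simp: L_def couplings_def)
  have massL: "emeasure (L k) (space (L k)) = (if k = 0 then 1 else emeasure (\<rho>s k) UNIV)" if k: "k \<in> {0..N}" for k
  proof (cases "k = 0")
    case True
    have "prob_space (return (config_space 0) (\<lambda>_. undefined :: real ^ 'd))"
      by (rule prob_space_return) (simp add: space_PiM)
    then show ?thesis using True by (simp add: L_def prob_space.emeasure_space_1)
  next
    case False
    then have k1: "k \<in> {1..N}" "1 \<in> {1..k}" using k by auto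
    have "emeasure (\<rho>s k) UNIV = emeasure (L k) ((\<lambda>x. x 1) -` UNIV \<inter> space (L k))"
      unfolding marg[OF k1, symmetric] by (intro emeasure_distr comp[OF k k1(2)]) simp
    then show ?thesis using False by simp
  qed
  have finL: "finite_measure (L k)" if k: "k \<in> {0..N}" for k
    using massL[OF k] \<rho>s(2)[of k] k by (intro finite_measureI) (auto simp: top_unique split: if_splits)
  have total: "(\<Sum>k=0..N. ennreal (w k) * emeasure (L k) (space (L k))) = 1"
  proof -
    have "(\<Sum>k=0..N. ennreal (w k) * emeasure (L k) (space (L k))) =
        ennreal m0 + (\<Sum>k=1..N. ennreal (w k) * emeasure (L k) (space (L k)))"
      by (subst sum.atLeast_Suc_atMost) (auto simp: w_def massL)
    also have "(\<Sum>k=1..N. ennreal (w k) * emeasure (L k) (space (L k))) = ennreal (1 - m0)"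
      unfolding m0_def using tot_meas by (simp add: w_def massL)
    also have "ennreal m0 + ennreal (1 - m0) = 1"
    proof -
      have "0 \<le> 1 - m0" by (simp add: m0_def sum_nonneg)
      then show ?thesis using m0 by (simp flip: ennreal_plus)
    qed
    finally show ?thesis .
  qed
  \<comment> \<open>The far particles depend on the configuration: a fixed far point could have infinite expected
    interaction with \<open>\<rho>s k\<close>.\<close>
  define far where "far n k j x = (real j * real (Suc n) + (\<Sum>i=1..k. norm (x i))) *\<^sub>R u"
    for n k j and x :: "nat \<Rightarrow> real ^ 'd"
  define F where "F n k j x = (if j \<le> k then x j else far n k j x)"
    for n k j and x :: "nat \<Rightarrow> real ^ 'd"
  define G where "G n k x = (\<lambda>j\<in>{1..N}. F n k j x)" for n k and x :: "nat \<Rightarrow> real ^ 'd"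
  have farm: "far n k j \<in> borel_measurable (L k)" if "k \<in> {0..N}" for n k j
    unfolding far_def
    by (intro borel_measurable_scaleR borel_measurable_add borel_measurable_sum
        measurable_compose[OF comp[OF that]] borel_measurable_const) auto
  have Fm: "F n k j \<in> borel_measurable (L k)" if "k \<in> {0..N}" "1 \<le> j" for n k j
    using farm[OF that(1), of n j] comp[OF that(1), of j] that(2)
    by (cases "j \<le> k") (simp_all add: F_def[abs_def])
  have Gm: "G n k \<in> measurable (L k) (config_space N)" if "k \<in> {0..N}" for n k
    unfolding G_def using that by (intro measurable_restrict Fm) auto
  have norm_far: "norm (far n k j x) = real j * real (Suc n) + (\<Sum>i=1..k. norm (x i))" for n k j x
    by (simp add: far_def u sum_nonneg)
  \<comment> \<open>Against a finite particle, the sum of norms in \<open>far\<close> absorbs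
    \<open>norm (x i)\<close>. Between two far particles this sum cancels, and the different
    multiples of \<open>real (Suc n)\<close> keep them apart.\<close>
  have dist_far: "real (Suc n) \<le> norm (F n k i x - F n k j x)" if ij: "1 \<le> i" "i < j" "k < j" for n k i j x
  proof (cases "i \<le> k")
    case True
    have "norm (x i) \<le> (\<Sum>i=1..k. norm (x i))"
      using True ij by (intro member_le_sum) auto
    moreover have "real (Suc n) \<le> real j * real (Suc n)" using ij by (simp add: mult_le_cancel_right1)
    ultimately have "real (Suc n) \<le> norm (far n k j x) - norm (x i)"
      unfolding norm_far by linarith
    also have "\<dots> \<le> norm (x i - far n k j x)" by (metis norm_minus_commute norm_triangle_ineq2)
    finally show ?thesis using True ij by (simp add: F_def)
  next
    case False
    have "far n k i x - far n k j x = ((real i - real j) * real (Suc n)) *\<^sub>R u"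
      by (simp add: far_def algebra_simps)
    then have "norm (far n k i x - far n k j x) = (real j - real i) * real (Suc n)"
      using ij u by (simp add: abs_mult)
    moreover have "1 * real (Suc n) \<le> (real j - real i) * real (Suc n)"
      using ij by (intro mult_right_mono) auto
    ultimately show ?thesis using False ij by (simp add: F_def)
  qed
  let ?T = "\<lambda>k. {(i, j). 1 \<le> i \<and> i < j \<and> j \<le> (k::nat)}"
  \<comment> \<open>An upper bound for the cost of all pairs that contain a far particle, uniform in
    the configuration.\<close>
  define c where "c n = real (card (?T N)) / real (Suc n)" for n :: nat
  have cost_G: "coulomb N (G n k x) \<le> coulomb k x + ennreal (c n)" if k: "k \<le> N" for n k x
  proof -
    let ?t = "\<lambda>(i, j). 1 / ennreal (norm (x i - x j))"
    have "coulomb N (G n k x) = coulomb N (\<lambda>j. F n k j x)"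
      by (rule coulomb_cong) (simp add: G_def)
    also have "\<dots> \<le> (\<Sum>p\<in>?T N. (if p \<in> ?T k then ?t p else 0) + ennreal (1 / real (Suc n)))"
      unfolding coulomb_def
    proof (rule sum_mono, clarify)
      fix i j assume ij: "1 \<le> i" "i < j" "j \<le> N"
      show "1 / ennreal (norm (F n k i x - F n k j x)) \<le>
          (if (i, j) \<in> ?T k then 1 / ennreal (norm (x i - x j)) else 0) + ennreal (1 / real (Suc n))"
      proof (cases "j \<le> k")
        case True
        then show ?thesis using ij by (simp add: F_def)
      next
        case False
        then have d: "real (Suc n) \<le> norm (F n k i x - F n k j x)" using ij by (intro dist_far) auto
        then have p: "0 < norm (F n k i x - F n k j x)" by (intro less_le_trans[OF _ d]) simp
        have "1 / ennreal (norm (F n k i x - F n k j x)) = ennreal (1 / norm (F n k i x - F n k j x))"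
          using divide_ennreal[of 1, OF _ p] by simp
        also have "\<dots> \<le> ennreal (1 / real (Suc n))"
          using d by (intro ennreal_leI divide_left_mono mult_pos_pos p) auto
        finally show ?thesis by (rule order_trans) simp
      qed
    qed
    also have "\<dots> = (\<Sum>p\<in>?T N. if p \<in> ?T k then ?t p else 0) + of_nat (card (?T N)) * ennreal (1 / real (Suc n))"
      by (simp only: sum.distrib sum_constant)
    also have "(\<Sum>p\<in>?T N. if p \<in> ?T k then ?t p else 0) = (\<Sum>p\<in>?T N \<inter> ?T k. ?t p)"
      by (rule sum.inter_restrict[OF finite_pairs, symmetric])
    also have "?T N \<inter> ?T k = ?T k" using k by auto
    also have "of_nat (card (?T N)) * ennreal (1 / real (Suc n)) = ennreal (c n)"
      unfolding c_def by (simp add: ennreal_of_nat_eq_real_of_nat flip: ennreal_mult')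
    finally show ?thesis by (simp add: coulomb_def)
  qed
  have "\<exists>M. sets M = sets (config_space N) \<and> (\<forall>A\<in>sets (config_space N).
      emeasure M A = (\<Sum>k\<in>{0..N}. ennreal (w k) * emeasure (L k) (G n k -` A \<inter> space (L k))))" for n
    by (rule mixture_exists[OF finite_atLeastAtMost Gm])
  from choice[OF allI[OF this]] obtain M where M_spec: "\<forall>n. sets (M n) = sets (config_space N) \<and>
      (\<forall>A\<in>sets (config_space N).
      emeasure (M n) A = (\<Sum>k\<in>{0..N}. ennreal (w k) * emeasure (L k) (G n k -` A \<inter> space (L k))))" ..
  have M: "sets (M n) = sets (config_space N)" "A \<in> sets (config_space N) \<Longrightarrow>
      emeasure (M n) A = (\<Sum>k\<in>{0..N}. ennreal (w k) * emeasure (L k) (G n k -` A \<inter> space (L k)))" for n A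
    using spec[OF M_spec, of n] by blast+
  have GM: "G n k \<in> measurable (L k) (M n)" if "k \<in> {0..N}" for n k
    using Gm[OF that, of n] unfolding measurable_cong_sets[OF refl M(1)] .
  have Mc: "(\<lambda>x. x i) \<in> borel_measurable (M n)" if "i \<in> {1..N}" for i n
    unfolding measurable_cong_sets[OF M(1) refl] using that by (rule measurable_component_singleton)
  have M1: "emeasure (M n) (space (M n)) = 1" for n
  proof -
    have "emeasure (M n) (space (M n)) = (\<Sum>k\<in>{0..N}. ennreal (w k) * emeasure (L k) (space (L k)))"
    proof (subst M(2))
      show "space (M n) \<in> sets (config_space N)" using sets.top[of "M n"] M(1) by simp
      have "G n k -` space (M n) \<inter> space (L k) = space (L k)" if "k \<in> {0..N}" for k
        using measurable_space[OF GM[OF that]] by auto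
      then show "(\<Sum>k = 0..N. ennreal (w k) * emeasure (L k) (G n k -` space (M n) \<inter> space (L k))) =
          (\<Sum>k = 0..N. ennreal (w k) * emeasure (L k) (space (L k)))" by simp
    qed
    then show ?thesis using total by simp
  qed
  have M_prob: "prob_space (M n)" for n using M1 by (rule prob_spaceI)
  have "\<exists>\<mu>. \<mu> \<in> Probs \<and> mm_cost N \<mu> \<le> (\<integral>\<^sup>+x. coulomb N x \<partial>M n) \<and>
      (\<forall>A\<in>sets borel. emeasure \<mu> A = (\<Sum>i=1..N. ennreal (1 / real N) * emeasure (M n) ((\<lambda>x. x i) -` A \<inter> space (M n))))" for n
  proof (rule cyclic_symmetrization[where X="\<lambda>i x. x i" and M="M n", OF N Mc])
    fix P' \<mu> assume *: "sets \<mu> = sets borel" "P' \<in> couplings N \<mu>"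
      "\<And>A. A \<in> sets borel \<Longrightarrow>
        emeasure \<mu> A = (\<Sum>i=1..N. ennreal (1 / real N) * emeasure (M n) ((\<lambda>x. x i) -` A \<inter> space (M n)))"
      "(\<integral>\<^sup>+x. coulomb N x \<partial>P') = (\<integral>\<^sup>+x. coulomb N x \<partial>M n)"
    have "emeasure \<mu> UNIV = (ennreal (real N) * ennreal (1 / real N)) * 1"
      by (subst *(3)) (auto simp: M1 ennreal_of_nat_eq_real_of_nat)
    then have \<mu>1: "emeasure \<mu> UNIV = 1" using N by (simp flip: ennreal_mult')
    have \<mu>: "\<mu> \<in> Probs"
      unfolding Probs_def using *(1) \<mu>1 sets_eq_imp_space_eq[OF *(1)] by (auto intro: prob_spaceI)
    have sP: "sets P' = sets (config_space N)" and mP: "distr P' borel (\<lambda>x. x 1) = \<mu>"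
      using *(2) N by (auto simp: couplings_def)
    have "(\<lambda>x. x 1) \<in> borel_measurable P'"
      unfolding measurable_cong_sets[OF sP refl] using N by (intro measurable_component_singleton) simp
    then have "emeasure \<mu> UNIV = emeasure P' ((\<lambda>x. x 1) -` UNIV \<inter> space P')"
      unfolding mP[symmetric] by (intro emeasure_distr) auto
    then have "prob_space P'" using \<mu>1 by (intro prob_spaceI) simp
    then have "mm_cost N \<mu> \<le> (\<integral>\<^sup>+x. coulomb N x \<partial>P')"
      unfolding mm_cost_def using *(2) by (intro INF_lower) simp
    then show ?thesis using *(3,4) \<mu> by (intro exI[of _ \<mu>]) simp
  qed
  from choice[OF allI[OF this]] obtain \<mu> where \<mu>_spec:
    "\<forall>n. \<mu> n \<in> Probs \<and> mm_cost N (\<mu> n) \<le> (\<integral>\<^sup>+x. coulomb N x \<partial>M n) \<and>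
      (\<forall>A\<in>sets borel. emeasure (\<mu> n) A = (\<Sum>i=1..N. ennreal (1 / real N) * emeasure (M n) ((\<lambda>x. x i) -` A \<inter> space (M n))))" ..
  have \<mu>: "\<mu> n \<in> Probs" "mm_cost N (\<mu> n) \<le> (\<integral>\<^sup>+x. coulomb N x \<partial>M n)"
    "A \<in> sets borel \<Longrightarrow>
      emeasure (\<mu> n) A = (\<Sum>i=1..N. ennreal (1 / real N) * emeasure (M n) ((\<lambda>x. x i) -` A \<inter> space (M n)))" for n A
    using spec[OF \<mu>_spec, of n] by blast+
  define K where "K = (\<Sum>k=1..N. \<integral>\<^sup>+x. coulomb k x \<partial>P k)"
  have cost: "mm_cost N (\<mu> n) \<le> K + ennreal (c n)" for n
  proof -
    have cm: "coulomb k \<in> borel_measurable (L k)" if "k \<in> {0..N}" for k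
      unfolding measurable_cong_sets[OF sL[OF that] refl] by (rule coulomb_measurable_config)
    have "mm_cost N (\<mu> n) \<le> (\<integral>\<^sup>+x. coulomb N x \<partial>M n)" by (rule \<mu>(2))
    also have "\<dots> = (\<Sum>k\<in>{0..N}. ennreal (w k) * (\<integral>\<^sup>+x. coulomb N (G n k x) \<partial>L k))"
    proof (rule nn_integral_mixture[OF _ GM])
      show "coulomb N \<in> borel_measurable (M n)"
        unfolding measurable_cong_sets[OF M(1) refl] by (rule coulomb_measurable_config)
    qed (use M in auto)
    also have "\<dots> \<le> (\<Sum>k\<in>{0..N}. ennreal (w k) * (\<integral>\<^sup>+x. coulomb k x + ennreal (c n) \<partial>L k))"
      by (intro sum_mono mult_left_mono nn_integral_mono cost_G) auto
    also have "\<dots> = (\<Sum>k\<in>{0..N}. ennreal (w k) * (\<integral>\<^sup>+x. coulomb k x \<partial>L k) +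
        ennreal (c n) * (ennreal (w k) * emeasure (L k) (space (L k))))"
      using cm by (intro sum.cong refl) (simp add: nn_integral_add distrib_left mult_ac)
    also have "\<dots> = (\<Sum>k\<in>{0..N}. ennreal (w k) * (\<integral>\<^sup>+x. coulomb k x \<partial>L k)) + ennreal (c n)"
      using total by (simp add: sum.distrib flip: sum_distrib_left)
    also have "(\<Sum>k\<in>{0..N}. ennreal (w k) * (\<integral>\<^sup>+x. coulomb k x \<partial>L k)) = K"
    proof -
      have "coulomb 0 = (\<lambda>x :: nat \<Rightarrow> real ^ 'd. 0)"
        unfolding coulomb_def fun_eq_iff by (intro allI sum.neutral) auto
      then show ?thesis
        by (subst sum.atLeast_Suc_atMost) (auto simp: K_def w_def L_def)
    qed
    finally show ?thesis .
  qed
  have weak: "weak_star_conv \<mu> \<rho>"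
    unfolding weak_star_conv_def
  proof
    fix f :: "real ^ 'd \<Rightarrow> real" assume f: "f \<in> C0_functions"
    then have fm: "f \<in> borel_measurable borel" and f0: "(f \<longlongrightarrow> 0) at_infinity"
      by (auto simp: C0_functions_def intro: borel_measurable_continuous_onI)
    obtain B where B: "\<And>x. \<bar>f x\<bar> \<le> B" by (rule C0_bounded[OF f]) blast
    have s\<mu>: "sets (\<mu> n) = sets borel" for n using \<mu>(1) by (simp add: Probs_def)
    have int\<mu>: "(\<integral>x. f x \<partial>\<mu> n) = (\<Sum>i=1..N. 1 / real N * (\<Sum>k\<in>{0..N}. w k * (\<integral>x. f (F n k i x) \<partial>L k)))" for n
    proof -
      have "(\<integral>x. f x \<partial>\<mu> n) = (\<Sum>i=1..N. 1 / real N * (\<integral>x. f (x i) \<partial>M n))"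
        using M_prob[of n] Mc fm B \<mu>(3)[of _ n] s\<mu>[of n]
        by (intro integral_mixture[where C=B]) (auto simp: prob_space.finite_measure measurable_cong_sets[OF _ s\<mu>] measurable_cong_sets[OF s\<mu>])
      also have "(\<integral>x. f (x i) \<partial>M n) = (\<Sum>k\<in>{0..N}. w k * (\<integral>x. f (G n k x i) \<partial>L k))" if "i \<in> {1..N}" for i
        using w0 finL M B measurable_compose[OF Mc[OF that] fm]
        by (intro integral_mixture[where C=B] GM) auto
      ultimately show ?thesis by (simp add: G_def)
    qed
    \<comment> \<open>A finite particle keeps its law for every \<open>n\<close>. A far one tends to
      infinity pointwise, so dominated convergence gives 0 for \<open>f\<close> vanishing at
      infinity.\<close>
    have lim: "(\<lambda>n. \<integral>x. f (F n k i x) \<partial>L k) \<longlonglongrightarrow> (if i \<le> k then \<integral>x. f x \<partial>\<rho>s k else 0)"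
      if i: "i \<in> {1..N}" and k: "k \<in> {0..N}" for i k
    proof (cases "i \<le> k")
      case True
      then have ki: "k \<in> {1..N}" "i \<in> {1..k}" using i k by auto
      have "(\<integral>x. f (x i) \<partial>L k) = (\<integral>x. f x \<partial>distr (L k) borel (\<lambda>x. x i))"
        by (rule integral_distr[OF comp[OF k ki(2)] fm, symmetric])
      then show ?thesis using True marg[OF ki] by (simp add: F_def)
    next
      case False
      interpret finite_measure "L k" by (rule finL[OF k])
      have "(\<lambda>n. \<integral>x. f (F n k i x) \<partial>L k) \<longlonglongrightarrow> (\<integral>x. 0 \<partial>L k)"
      proof (rule integral_dominated_convergence[where w="\<lambda>_. B"])
        show "AE x in L k. (\<lambda>n. f (F n k i x)) \<longlonglongrightarrow> 0"
        proof (rule AE_I2)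
          fix x
          have "real n \<le> norm (F n k i x)" for n
          proof -
            have "real n \<le> 1 * real (Suc n)" by simp
            also have "\<dots> \<le> real i * real (Suc n)" using i by (intro mult_right_mono) auto
            also have "\<dots> \<le> norm (far n k i x)" unfolding norm_far by (simp add: sum_nonneg)
            finally show ?thesis using False by (simp add: F_def)
          qed
          then have "filterlim (\<lambda>n. norm (F n k i x)) at_top sequentially"
            by (intro filterlim_at_top_mono[OF filterlim_real_sequentially] always_eventually allI)
          then have "filterlim (\<lambda>n. F n k i x) at_infinity sequentially"
            by (rule filterlim_norm_at_top_imp_at_infinity)
          then show "(\<lambda>n. f (F n k i x)) \<longlonglongrightarrow> 0" by (rule filterlim_compose[OF f0])
        qed
      qed (use B measurable_compose[OF Fm fm] i k in auto)
      then show ?thesis using False by simp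
    qed
    have "(\<lambda>n. \<integral>x. f x \<partial>\<mu> n) \<longlonglongrightarrow>
        (\<Sum>i=1..N. 1 / real N * (\<Sum>k\<in>{0..N}. w k * (if i \<le> k then \<integral>x. f x \<partial>\<rho>s k else 0)))"
      unfolding int\<mu> by (intro tendsto_sum tendsto_mult tendsto_const lim)
    also have "(\<Sum>i=1..N. 1 / real N * (\<Sum>k\<in>{0..N}. w k * (if i \<le> k then \<integral>x. f x \<partial>\<rho>s k else 0))) =
        (\<Sum>k\<in>{0..N}. \<Sum>i=1..N. if i \<le> k then 1 / real N * (w k * (\<integral>x. f x \<partial>\<rho>s k)) else 0)"
      unfolding sum_distrib_left by (subst sum.swap) (intro sum.cong refl, simp)
    also have "\<dots> = (\<Sum>k\<in>{0..N}. real k / real N * (w k * (\<integral>x. f x \<partial>\<rho>s k)))"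
    proof (rule sum.cong[OF refl])
      fix k assume "k \<in> {0..N}"
      \<comment> \<open>The count of finite positions turns the uniform weight 1/N into k/N.\<close>
      then have "{1..N} \<inter> {i. i \<le> k} = {1..k}" by auto
      then show "(\<Sum>i=1..N. if i \<le> k then 1 / real N * (w k * (\<integral>x. f x \<partial>\<rho>s k)) else 0) =
          real k / real N * (w k * (\<integral>x. f x \<partial>\<rho>s k))"
        by (simp add: sum.If_cases)
    qed
    also have "\<dots> = (\<Sum>k=1..N. real k / real N * (\<integral>x. f x \<partial>\<rho>s k))"
      by (subst sum.atLeast_Suc_atMost) (auto simp: w_def)
    also have "\<dots> = (\<integral>x. f x \<partial>\<rho>)"
    proof (rule integral_mixture[symmetric, where C=B])
      have s\<rho>: "sets \<rho> = sets borel" using \<rho> by (simp add: Subprobs_def)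
      show "(\<lambda>x. x) \<in> measurable (\<rho>s k) \<rho>" if "k \<in> {1..N}" for k
        unfolding measurable_cong_sets[OF \<rho>s(1)[OF that] s\<rho>] by simp
      show "f \<in> borel_measurable \<rho>" unfolding measurable_cong_sets[OF s\<rho> refl] by (rule fm)
      fix A assume "A \<in> sets \<rho>"
      then have "A \<in> sets borel" using s\<rho> by simp
      then show "emeasure \<rho> A = (\<Sum>k=1..N. ennreal (real k / real N) * emeasure (\<rho>s k) ((\<lambda>x. x) -` A \<inter> space (\<rho>s k)))"
        using sets_eq_imp_space_eq[OF \<rho>s(1)] by (simp add: id[symmetric])
    qed (use fin\<rho> B in auto)
    finally show "(\<lambda>n. \<integral>x. f x \<partial>\<mu> n) \<longlonglongrightarrow> (\<integral>x. f x \<partial>\<rho>)" .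
  qed
  have "relaxed_cost N \<rho> \<le> liminf (\<lambda>n. mm_cost N (\<mu> n))"
    unfolding relaxed_cost_def using \<mu>(1) weak by (intro INF_lower) simp
  also have "\<dots> \<le> liminf (\<lambda>n. K + ennreal (c n))"
    by (intro Liminf_mono always_eventually allI cost)
  also have "\<dots> = K"
  proof -
    have "c \<longlonglongrightarrow> 0" unfolding c_def by (intro LIMSEQ_Suc lim_const_over_n)
    then have "(\<lambda>n. K + ennreal (c n)) \<longlonglongrightarrow> K + ennreal 0"
      by (intro tendsto_add tendsto_const tendsto_ennrealI)
    then show ?thesis by (intro lim_imp_Liminf) auto
  qed
  finally show ?thesis by (simp add: K_def)
qed

text \<open>Each \<open>partial_cost\<close> is approached by a coupling with error
  \<open>e / real N\<close>, hence total error \<open>e\<close>. Finiteness of the sum provides such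
  couplings for \<open>k \<ge> 2\<close>.\<close>

lemma relaxed_cost_le_decomposition:
  fixes \<rho> :: "(real ^ 'd) measure"
  assumes N: "1 \<le> N" and \<rho>: "\<rho> \<in> Subprobs" and dec: "\<rho>s \<in> decompositions N \<rho>"
  shows "relaxed_cost N \<rho> \<le> (\<Sum>k=1..N. partial_cost k (\<rho>s k))"
proof (rule ennreal_le_epsilon)
  fix e :: real assume fin: "(\<Sum>k=1..N. partial_cost k (\<rho>s k)) < top" and e: "0 < e"
  have "\<exists>P \<in> couplings k (\<rho>s k). (\<integral>\<^sup>+x. coulomb k x \<partial>P) \<le> partial_cost k (\<rho>s k) + ennreal (e / real N)"
    if k: "k \<in> {1..N}" for k
  proof (cases "k = 1")
    case True
    have s: "sets (\<rho>s k) = sets borel" using dec k by (auto simp: decompositions_def Subprobs_def)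
    \<comment> \<open>For \<open>k = 1\<close> the partial cost is 0 by definition and not as an
      infimum, so the coupling is built by hand: \<open>\<rho>s k\<close> carried to one-particle
      configurations.\<close>
    define P where "P = distr (\<rho>s k) (config_space k) (\<lambda>x. \<lambda>j\<in>{1..k}. x)"
    have m: "(\<lambda>x. \<lambda>j\<in>{1..k}. x) \<in> measurable (\<rho>s k) (config_space k)"
      unfolding measurable_cong_sets[OF s refl] by (intro measurable_restrict) simp
    have "distr P borel (\<lambda>x. x 1) = \<rho>s k"
    proof -
      have "(\<lambda>x. x 1) \<in> borel_measurable (config_space k)"
        using True by (intro measurable_component_singleton) simp
      then have "distr P borel (\<lambda>x. x 1) = distr (\<rho>s k) borel ((\<lambda>x. x 1) \<circ> (\<lambda>x. \<lambda>j\<in>{1..k}. x))"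
        unfolding P_def by (rule distr_distr[OF _ m])
      also have "\<dots> = distr (\<rho>s k) (\<rho>s k) (\<lambda>x. x)"
        using s True by (intro distr_cong) auto
      finally show ?thesis by (simp add: distr_id)
    qed
    then have "P \<in> couplings k (\<rho>s k)" using True by (simp add: couplings_def P_def)
    moreover have "coulomb k x = 0" for x :: "nat \<Rightarrow> real ^ 'd"
      unfolding coulomb_def by (rule sum.neutral) (use True in auto)
    ultimately show ?thesis by (intro bexI[of _ P]) auto
  next
    case False
    have "partial_cost k (\<rho>s k) \<noteq> top" using fin k by (auto simp: ennreal_sum_less_top less_top)
    then have "partial_cost k (\<rho>s k) < partial_cost k (\<rho>s k) + ennreal (e / real N)"
      using e N ennreal_add_left_cancel_less[of "partial_cost k (\<rho>s k)" 0] by (simp add: less_top)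
    then have "(INF P \<in> couplings k (\<rho>s k). \<integral>\<^sup>+ x. coulomb k x \<partial>P) < partial_cost k (\<rho>s k) + ennreal (e / real N)"
      using False by (simp add: partial_cost_def)
    then show ?thesis unfolding INF_less_iff by (auto intro: less_imp_le)
  qed
  then obtain P where P: "\<And>k. k \<in> {1..N} \<Longrightarrow> P k \<in> couplings k (\<rho>s k)"
    "\<And>k. k \<in> {1..N} \<Longrightarrow> (\<integral>\<^sup>+x. coulomb k x \<partial>P k) \<le> partial_cost k (\<rho>s k) + ennreal (e / real N)"
    by metis
  have "relaxed_cost N \<rho> \<le> (\<Sum>k=1..N. \<integral>\<^sup>+x. coulomb k x \<partial>P k)"
    by (rule upper_bound_of_couplings[OF N dec \<rho> P(1)])
  also have "\<dots> \<le> (\<Sum>k=1..N. partial_cost k (\<rho>s k) + ennreal (e / real N))"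
    by (intro sum_mono P(2))
  also have "\<dots> = (\<Sum>k=1..N. partial_cost k (\<rho>s k)) + ennreal e"
    using N e by (simp add: sum.distrib ennreal_of_nat_eq_real_of_nat flip: ennreal_mult')
  finally show "relaxed_cost N \<rho> \<le> (\<Sum>k=1..N. partial_cost k (\<rho>s k)) + ennreal e" .
qed

theorem theorem2p2:
  fixes \<rho> :: "(real ^ 'd) measure" and N :: nat
  assumes "N \<ge> 2" and "\<rho> \<in> Subprobs"
  shows "relaxed_cost N \<rho> =
           (INF \<rho>s \<in> decompositions N \<rho>. \<Sum>k=1..N. partial_cost k (\<rho>s k)) \<and>
         (relaxed_cost N \<rho> < \<infinity> \<longrightarrow>
           (\<exists>\<rho>s \<in> decompositions N \<rho>.
              (\<Sum>k=1..N. partial_cost k (\<rho>s k)) =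
              (INF \<rho>s \<in> decompositions N \<rho>. \<Sum>k=1..N. partial_cost k (\<rho>s k))))"
proof -
  have N: "1 \<le> N" using assms(1) by simp
  have le: "relaxed_cost N \<rho> \<le> (INF \<rho>s \<in> decompositions N \<rho>. \<Sum>k=1..N. partial_cost k (\<rho>s k))"
    by (intro INF_greatest relaxed_cost_le_decomposition N assms(2))
  show ?thesis
  proof (cases "relaxed_cost N \<rho> < \<infinity>")
    case True
    then obtain \<rho>s where \<rho>s: "\<rho>s \<in> decompositions N \<rho>"
      "(\<Sum>k=1..N. partial_cost k (\<rho>s k)) \<le> relaxed_cost N \<rho>"
      using relaxed_cost_attained[OF N assms(2)] by blast
    have ge: "(INF \<rho>s \<in> decompositions N \<rho>. \<Sum>k=1..N. partial_cost k (\<rho>s k)) \<le> (\<Sum>k=1..N. partial_cost k (\<rho>s k))"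
      by (rule INF_lower[OF \<rho>s(1)])
    have "(\<Sum>k=1..N. partial_cost k (\<rho>s k)) = (INF \<rho>s \<in> decompositions N \<rho>. \<Sum>k=1..N. partial_cost k (\<rho>s k))"
      by (rule antisym[OF order_trans[OF \<rho>s(2) le] ge])
    then show ?thesis using antisym[OF le order_trans[OF ge \<rho>s(2)]] \<rho>s(1) by blast
  next
    case False
    \<comment> \<open>An infinite relaxed cost forces the infimum to be infinite by
      \<open>le\<close>, and attainment is then not claimed.\<close>
    then have "relaxed_cost N \<rho> = top" by (simp flip: less_top)
    then show ?thesis using le by (simp add: top_unique)
  qed
qed

end
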